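(* Let $k,l\ge0$. Then $[\tilde\psi_k,\tilde\psi_l]=\tilde\psi_k\tilde\psi_l-\tilde\psi_l\tilde\psi_k=0$.
   Context: Algebra. Let $q_1$ be an indeterminate, $q=q_1^2$, $q_0=q^2$ (powers $q^a$ with $a\in\frac12\mathbb Z$ lie in $\mathbb Q(q_1)$). Let $I=\{0,1\}$; for $i\in I$, $[k]_i=(q_i^k-q_i^{-k})/(q_i-q_i^{-1})$, $[n]_i!=\prod_{p=1}^n[p]_i$, $[0]_i!=1$. Let $X,Y$ be finitely generated free $\mathbb Z$-modules with perfect pairing $\langle\,,\rangle:Y\times X\to\mathbb Z$, with linearly independent simple roots $\alpha_0,\alpha_1\in X$ and linearly independent simple coroots $h_0,h_1\in Y$, and $a_{ij}=\langle h_i,\alpha_j\rangle$: $a_{00}=a_{11}=2$, $a_{01}=-1$, $a_{10}=-4$ (type $A_2^{(2)}$); $\delta=\alpha_0+2\alpha_1$. $\mathbf U$ is the $\mathbb Q(q_1)$-algebra generated by $q^h$ ($h\in\frac12Y$), $e_i,f_i$ ($i\in I$) with relations $q^0=1$, $q^hq^{h'}=q^{h+h'}$, $q^he_iq^{-h}=q^{\langle h,\alpha_i\rangle}e_i$, $q^hf_iq^{-h}=q^{-\langle h,\alpha_i\rangle}f_i$, $[e_i,f_j]=\delta_{ij}\frac{k_i-k_i^{-1}}{q_i-q_i^{-1}}$, and for $i\ne j$ $\sum_{k=0}^{1-a_{ij}}(-1)^ke_i^{(k)}e_je_i^{(1-a_{ij}-k)}=0$ and the same with $f$ in place of $e$,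 where $k_0=q^{2h_0}$, $k_1=q^{h_1/2}$, $e_i^{(k)}=e_i^k/[k]_i!$, $f_i^{(k)}=f_i^k/[k]_i!$. Braid operators. $T_i$ ($i\in I$) is the automorphism of $\mathbf U$ with $T_i(q^h)=q^{h-\langle h,\alpha_i\rangle h_i}$, $T_i(e_i)=-f_ik_i$, $T_i(f_i)=-k_i^{-1}e_i$, and for $j\neq i$: $T_i(e_j)=\sum_{r=0}^{-a_{ij}}(-1)^rq_i^{-r}e_i^{(-a_{ij}-r)}e_je_i^{(r)}$, $T_i(f_j)=\sum_{r=0}^{-a_{ij}}(-1)^rq_i^{r}f_i^{(r)}f_jf_i^{(-a_{ij}-r)}$. Root vectors. For $n\ge0$: $E_{n\delta+\alpha_1}=(T_1^{-1}T_0^{-1})^n(e_1)$, and $E_{\delta-\alpha_1}=T_0(e_1)$. For $n\ge1$: $\tilde\psi_n=E_{\delta-\alpha_1}E_{(n-1)\delta+\alpha_1}-q^{-1}E_{(n-1)\delta+\alpha_1}E_{\delta-\alpha_1}$; and $\tilde\psi_0=(q_1-q_1^{-1})^{-1}$. *)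

theory Defs
  imports
    Complex_Main
    "HOL-Library.Poly_Mapping"
    "HOL-Computational_Algebra.Polynomial"
    "HOL-Computational_Algebra.Fraction_Field"
begin

section \<open>The ground field and quantum integers\<close>

text \<open>The field of rational functions over the rationals in one indeterminate \<open>q1\<close>.\<close>

type_synonym qfield = "rat poly fract"

definition q1 :: qfield where "q1 = Fract [:0, 1:] 1"

definition q :: qfield where "q = q1 ^ 2"

datatype node = Node0 | Node1

fun qnode :: "node \<Rightarrow> qfield" where
  "qnode Node0 = q ^ 2"
| "qnode Node1 = q1"

definition qint :: "node \<Rightarrow> nat \<Rightarrow> qfield" where
  "qint i k = (qnode i ^ k - inverse (qnode i) ^ k) / (qnode i - inverse (qnode i))"

definition qfact :: "node \<Rightarrow> nat \<Rightarrow> qfield" where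
  "qfact i n = (\<Prod>p = 1..n. qint i p)"


section \<open>The root datum\<close>

fun cartan :: "node \<Rightarrow> node \<Rightarrow> int" where
  "cartan Node0 Node0 = 2"
| "cartan Node1 Node1 = 2"
| "cartan Node0 Node1 = - 1"
| "cartan Node1 Node0 = - 4"

text \<open>
  The lattices \<open>X\<close> and \<open>Y\<close> are the types \<open>'x\<close> and \<open>'y\<close>; \<open>sX\<close> and \<open>sY\<close> are their integer
  scalings. The pairing is perfect when both induced maps to the dual module are bijective
  (additive maps into the integers are the same as module homomorphisms); that the values lie in
  the dual also makes the pairing bilinear.
\<close>

locale root_datum_A22 =
  X: module sX + Y: module sY
  for sX :: "int \<Rightarrow> 'x::ab_group_add \<Rightarrow> 'x"
  and sY :: "int \<Rightarrow> 'y::ab_group_add \<Rightarrow> 'y" +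
  fixes pairing :: "'y \<Rightarrow> 'x \<Rightarrow> int"
    and \<alpha> :: "node \<Rightarrow> 'x"
    and h :: "node \<Rightarrow> 'y"
  assumes X_free: "\<exists>B. finite B \<and> X.independent B \<and> X.span B = UNIV"
    and Y_free: "\<exists>B. finite B \<and> Y.independent B \<and> Y.span B = UNIV"
    and perfect_left: "bij_betw pairing UNIV {\<phi>. additive \<phi>}"
    and perfect_right: "bij_betw (\<lambda>x y. pairing y x) UNIV {\<phi>. additive \<phi>}"
    and roots_independent: "inj \<alpha>" "X.independent (range \<alpha>)"
    and coroots_independent: "inj h" "Y.independent (range h)"
    and pairing_cartan: "pairing (h i) (\<alpha> j) = cartan i j"


section \<open>Algebras over the ground field\<close>

locale q_algebra = vector_space scale
  for scale :: "qfield \<Rightarrow> 'a::ring_1 \<Rightarrow> 'a" +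
  assumes scale_mult_left: "scale c x * y = scale c (x * y)"
    and scale_mult_right: "x * scale c y = scale c (x * y)"

definition alg_hom ::
  "(qfield \<Rightarrow> 'a::ring_1 \<Rightarrow> 'a) \<Rightarrow> (qfield \<Rightarrow> 'b::ring_1 \<Rightarrow> 'b) \<Rightarrow> ('a \<Rightarrow> 'b) \<Rightarrow> bool" where
  "alg_hom s1 s2 \<Phi> \<longleftrightarrow>
     Vector_Spaces.linear s1 s2 \<Phi> \<and> \<Phi> 1 = 1 \<and> (\<forall>x y. \<Phi> (x * y) = \<Phi> x * \<Phi> y)"

inductive_set two_sided_ideal :: "'a::ring_1 set \<Rightarrow> 'a set" for R :: "'a set" where
  gen: "r \<in> R \<Longrightarrow> r \<in> two_sided_ideal R"
| zero: "0 \<in> two_sided_ideal R"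
| add: "x \<in> two_sided_ideal R \<Longrightarrow> y \<in> two_sided_ideal R \<Longrightarrow> x + y \<in> two_sided_ideal R"
| left: "x \<in> two_sided_ideal R \<Longrightarrow> a * x \<in> two_sided_ideal R"
| right: "x \<in> two_sided_ideal R \<Longrightarrow> x * a \<in> two_sided_ideal R"


subsection \<open>Free algebras\<close>

text \<open>
  The free monoid, written additively so that \<open>'g word \<Rightarrow>\<^sub>0 qfield\<close>, with the convolution product
  of \<open>Poly_Mapping\<close>, is the free associative algebra on \<open>'g\<close>.
\<close>

datatype 'g word = Word (letters: "'g list")

instantiation word :: (type) monoid_add
begin

definition zero_word :: "'a word" where "0 = Word []"

definition plus_word :: "'a word \<Rightarrow> 'a word \<Rightarrow> 'a word" where
  "v + w = Word (letters v @ letters w)"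

instance
  by standard (simp_all add: zero_word_def plus_word_def)

end

type_synonym 'g free_algebra = "'g word \<Rightarrow>\<^sub>0 qfield"

definition free_scale :: "qfield \<Rightarrow> 'g free_algebra \<Rightarrow> 'g free_algebra" where
  "free_scale c x = Poly_Mapping.single 0 c * x"

definition free_gen :: "'g \<Rightarrow> 'g free_algebra" where
  "free_gen g = Poly_Mapping.single (Word [g]) 1"

lemma q_algebra_free_scale: "q_algebra (free_scale :: qfield \<Rightarrow> 'g free_algebra \<Rightarrow> _)"
proof -
  have central: "x * Poly_Mapping.single 0 c = Poly_Mapping.single 0 c * x"
    for c and x :: "'g free_algebra"
  proof (induction x rule: update_induct)
    case const
    show ?case by simp
  next
    case (update f a b)
    have "Poly_Mapping.update a b f = f + Poly_Mapping.single a b"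
      using update(1)
      by (auto intro!: poly_mapping_eqI
          simp: lookup_update lookup_add lookup_single when_def in_keys_iff)
    with update(3) show ?case
      by (simp add: algebra_simps mult_single)
  qed
  show ?thesis
  proof (unfold_locales, goal_cases)
    case 5
    then show ?case by (simp add: free_scale_def mult.assoc)
  next
    case (6 x c y)
    then show ?case by (metis free_scale_def mult.assoc central)
  qed (simp_all add: free_scale_def algebra_simps single_add mult_single flip: mult.assoc)
qed


section \<open>The quantum affine algebra\<close>

text \<open>
  The group-like generators are indexed by \<open>Y\<close> instead of half of \<open>Y\<close>: the generator \<open>Qgen y\<close>
  stands for \<open>q\<close> to the power \<open>y/2\<close>. Consequently \<open>q\<close> to the power \<open>\<langle>y/2, \<alpha>\<^sub>i\<rangle>\<close>
  is \<open>q1\<close> to the integer power \<open>\<langle>y, \<alpha>\<^sub>i\<rangle>\<close>.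
\<close>

datatype 'y gen = Qgen 'y | Egen node | Fgen node

text \<open>
  Below, \<open>G\<close> gives the images of the generators in some algebra with scalar multiplication \<open>s\<close>.
  The element \<open>k\<^sub>i\<close> is \<open>G (Qgen (kexp sY h i))\<close>: \<open>k\<^sub>0\<close> is \<open>q\<close> to the power
  \<open>2 h\<^sub>0 = (4 h\<^sub>0)/2\<close> and \<open>k\<^sub>1\<close> is \<open>q\<close> to the power \<open>h\<^sub>1/2\<close>.
\<close>

fun kexp :: "(int \<Rightarrow> 'y \<Rightarrow> 'y) \<Rightarrow> (node \<Rightarrow> 'y) \<Rightarrow> node \<Rightarrow> 'y" where
  "kexp sY h Node0 = sY 4 (h Node0)"
| "kexp sY h Node1 = h Node1"

definition divpow :: "(qfield \<Rightarrow> 'a::ring_1 \<Rightarrow> 'a) \<Rightarrow> node \<Rightarrow> 'a \<Rightarrow> nat \<Rightarrow> 'a" where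
  "divpow s i x n = s (inverse (qfact i n)) (x ^ n)"

definition serre :: "(qfield \<Rightarrow> 'a::ring_1 \<Rightarrow> 'a) \<Rightarrow> node \<Rightarrow> node \<Rightarrow> 'a \<Rightarrow> 'a \<Rightarrow> 'a" where
  "serre s i j x y =
     (let n = nat (1 - cartan i j)
      in \<Sum>k = 0..n. (- 1) ^ k * divpow s i x k * y * divpow s i x (n - k))"

definition relators ::
  "(int \<Rightarrow> 'y::ab_group_add \<Rightarrow> 'y) \<Rightarrow> ('y \<Rightarrow> 'x \<Rightarrow> int) \<Rightarrow> (node \<Rightarrow> 'x) \<Rightarrow> (node \<Rightarrow> 'y)
     \<Rightarrow> (qfield \<Rightarrow> 'a::ring_1 \<Rightarrow> 'a) \<Rightarrow> ('y gen \<Rightarrow> 'a) \<Rightarrow> 'a set" where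
  "relators sY pairing \<alpha> h s G =
     (let Q = (\<lambda>y. G (Qgen y)); e = (\<lambda>i. G (Egen i)); f = (\<lambda>i. G (Fgen i)); k = kexp sY h
      in {Q 0 - 1}
       \<union> {Q y * Q y' - Q (y + y') | y y'. True}
       \<union> {Q y * e i * Q (- y) - s (q1 powi pairing y (\<alpha> i)) (e i) | y i. True}
       \<union> {Q y * f i * Q (- y) - s (q1 powi (- pairing y (\<alpha> i))) (f i) | y i. True}
       \<union> {(e i * f i - f i * e i)
            - s (inverse (qnode i - inverse (qnode i))) (Q (k i) - Q (- k i)) | i. True}
       \<union> {e i * f j - f j * e i | i j. i \<noteq> j}
       \<union> {serre s i j (e i) (e j) | i j. i \<noteq> j}
       \<union> {serre s i j (f i) (f j) | i j. i \<noteq> j})"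

text \<open>
  The ring \<open>'u\<close> with scalar multiplication \<open>s\<close> is the algebra presented by the generators \<open>G\<close> and
  the relations above: it is the quotient of the free algebra by the two-sided ideal generated
  by the relators. (The relators depend on the root datum, so the quotient itself cannot be formed
  as a type.)
\<close>

definition is_quantum_algebra ::
  "(int \<Rightarrow> 'y::ab_group_add \<Rightarrow> 'y) \<Rightarrow> ('y \<Rightarrow> 'x \<Rightarrow> int) \<Rightarrow> (node \<Rightarrow> 'x) \<Rightarrow> (node \<Rightarrow> 'y)
     \<Rightarrow> (qfield \<Rightarrow> 'u::ring_1 \<Rightarrow> 'u) \<Rightarrow> ('y gen \<Rightarrow> 'u) \<Rightarrow> bool" where
  "is_quantum_algebra sY pairing \<alpha> h s G \<longleftrightarrow>
     q_algebra s \<and>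
     (\<exists>\<Phi>. alg_hom free_scale s \<Phi> \<and> surj \<Phi> \<and> (\<forall>g. \<Phi> (free_gen g) = G g) \<and>
          {x. \<Phi> x = 0} = two_sided_ideal (relators sY pairing \<alpha> h free_scale free_gen))"


section \<open>Braid operators and root vectors\<close>

text \<open>
  \<open>T\<close> is the automorphism \<open>T\<^sub>i\<close>; it is unique since its values on generators are prescribed.
\<close>

definition is_braid_automorphism ::
  "(int \<Rightarrow> 'y::ab_group_add \<Rightarrow> 'y) \<Rightarrow> ('y \<Rightarrow> 'x \<Rightarrow> int) \<Rightarrow> (node \<Rightarrow> 'x) \<Rightarrow> (node \<Rightarrow> 'y)
     \<Rightarrow> (qfield \<Rightarrow> 'u::ring_1 \<Rightarrow> 'u) \<Rightarrow> ('y gen \<Rightarrow> 'u) \<Rightarrow> node \<Rightarrow> ('u \<Rightarrow> 'u) \<Rightarrow> bool" where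
  "is_braid_automorphism sY pairing \<alpha> h s G i T \<longleftrightarrow>
     (let Q = (\<lambda>y. G (Qgen y)); e = (\<lambda>i. G (Egen i)); f = (\<lambda>i. G (Fgen i)); k = kexp sY h
      in alg_hom s s T \<and> bij T \<and>
         (\<forall>y. T (Q y) = Q (y - sY (pairing y (\<alpha> i)) (h i))) \<and>
         T (e i) = - (f i * Q (k i)) \<and>
         T (f i) = - (Q (- k i) * e i) \<and>
         (\<forall>j. j \<noteq> i \<longrightarrow>
            (let n = nat (- cartan i j)
             in T (e j) = (\<Sum>r = 0..n. s ((- 1) ^ r * inverse (qnode i) ^ r)
                            (divpow s i (e i) (n - r) * e j * divpow s i (e i) r)) \<and>
                T (f j) = (\<Sum>r = 0..n. s ((- 1) ^ r * qnode i ^ r)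
                            (divpow s i (f i) r * f j * divpow s i (f i) (n - r))))))"

text \<open>The root vectors of weight \<open>n\<delta> + \<alpha>\<^sub>1\<close> and \<open>\<delta> - \<alpha>\<^sub>1\<close>.\<close>

definition E_plus :: "('y gen \<Rightarrow> 'u) \<Rightarrow> (node \<Rightarrow> 'u \<Rightarrow> 'u) \<Rightarrow> nat \<Rightarrow> 'u" where
  "E_plus G T n = ((inv (T Node1) \<circ> inv (T Node0)) ^^ n) (G (Egen Node1))"

definition E_minus :: "('y gen \<Rightarrow> 'u) \<Rightarrow> (node \<Rightarrow> 'u \<Rightarrow> 'u) \<Rightarrow> 'u" where
  "E_minus G T = T Node0 (G (Egen Node1))"

fun psi ::
  "(qfield \<Rightarrow> 'u::ring_1 \<Rightarrow> 'u) \<Rightarrow> ('y gen \<Rightarrow> 'u) \<Rightarrow> (node \<Rightarrow> 'u \<Rightarrow> 'u) \<Rightarrow> nat \<Rightarrow> 'u" where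
  "psi s G T 0 = s (inverse (q1 - inverse q1)) 1"
| "psi s G T (Suc n) =
     E_minus G T * E_plus G T n - s (inverse q) (E_plus G T n * E_minus G T)"

end

theory Submission
  imports Defs "HOL-Computational_Algebra.Polynomial_Factorial"
    "HOL-Computational_Algebra.Formal_Power_Series"
begin

text \<open>
  Let \<open>\<sigma> = T\<^sub>0 T\<^sub>1\<close>. The root vectors of weight \<open>r\<delta> + \<alpha>\<^sub>1\<close> and \<open>s\<delta> - \<alpha>\<^sub>1\<close> belong to two families indexed by
  all integers: \<open>x\<^sub>r\<close> with \<open>\<sigma> x\<^sub>r = x\<^sub>r\<^sub>-\<^sub>1\<close> through \<open>x\<^sub>0 = e\<^sub>1\<close>, and \<open>y\<^sub>s\<close> with \<open>\<sigma> y\<^sub>s = y\<^sub>s\<^sub>+\<^sub>1\<close> through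
  \<open>y\<^sub>1 = T\<^sub>0 e\<^sub>1\<close>.
  Write \<open>\<langle>r, s\<rangle> = y\<^sub>s x\<^sub>r - q\<^sup>-\<^sup>1 x\<^sub>r y\<^sub>s\<close>, so that \<open>\<psi>\<^sub>n = \<langle>n-1, 1\<rangle>\<close> for positive \<open>n\<close>. The heart of the matter
  is that \<open>\<langle>r, s\<rangle>\<close> depends only on \<open>r + s\<close> when \<open>r + s\<close> is positive, or equivalently that every
  \<open>\<psi>\<^sub>n\<close> is fixed by \<open>\<sigma>\<close>.

  Granting this for indices up to \<open>N\<close>, an exchange relation holds for \<open>\<psi>\<^sub>n\<close> with \<open>n \<le> N\<close>
  (\<open>exchange_relation\<close>). With the generating series \<open>\<psi>(z) = \<Sum>\<^sub>n \<psi>\<^sub>n z\<^sup>n\<close> and the shift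
  \<open>S x\<^sub>r = x\<^sub>r\<^sub>+\<^sub>1\<close> it reads \<open>\<psi>(z) x\<^sub>r = (g(zS) x\<^sub>r) \<psi>(z)\<close>, where
  \<open>g(z) = (1 - q\<^sup>-\<^sup>2 z) (1 + q z) / ((1 - q\<^sup>2 z) (1 + q\<^sup>-\<^sup>1 z))\<close>. Reading the same argument in the opposite
  algebra gives the relation for \<open>y\<^sub>s\<close>, with \<open>1/g\<close> in place of \<open>g\<close>. Moving \<open>\<psi>(z)\<close> past \<open>\<langle>r, s\<rangle>\<close>
  therefore produces the coefficients of \<open>g \<cdot> 1/g = 1\<close>, and the elements commute (\<open>psi_commute\<close>).

  For the induction step (\<open>invariant_step\<close>) let \<open>D = \<langle>r+1, N-r\<rangle> - \<langle>r, N+1-r\<rangle>\<close> be the obstruction. On the one hand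
  \<open>[\<psi>\<^sub>1, \<psi>\<^sub>N] = c D\<close> with \<open>c = [2]\<^sub>1 [3]\<^sub>1\<close>, because
  \<open>[\<psi>\<^sub>1, x\<^sub>r] = c x\<^sub>r\<^sub>+\<^sub>1\<close> and \<open>[\<psi>\<^sub>1, y\<^sub>s] = - c y\<^sub>s\<^sub>+\<^sub>1\<close>; in particular \<open>D\<close>
  does not depend on \<open>r\<close>, so that \<open>\<langle>r, N+1-r\<rangle>\<close> is an arithmetic progression in \<open>r\<close>. On the other
  hand, moving \<open>\<psi>\<^sub>N\<close> past \<open>\<psi>\<^sub>1 = \<langle>0, 1\<rangle>\<close> with the exchange relation gives
  \<open>[\<psi>\<^sub>N, \<psi>\<^sub>1] = L\<^sub>N D \<psi>\<^sub>0\<close>, where \<open>L\<^sub>n\<close> is the \<open>n\<close>-th coefficient of \<open>z g'(z) / g(z)\<close>. As \<open>c = L\<^sub>1 \<psi>\<^sub>0\<close>,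
  this means \<open>(L\<^sub>N + L\<^sub>1) D = 0\<close>, and \<open>L\<^sub>N + L\<^sub>1\<close> does not vanish.

  What remains are finitely many relations of low degree: \<open>\<sigma> \<psi>\<^sub>1 = \<psi>\<^sub>1\<close>, the action of \<open>\<psi>\<^sub>1\<close> on \<open>x\<^sub>0\<close> and \<open>y\<^sub>1\<close>, and
  the behaviour of \<open>x\<^sub>r\<^sub>+\<^sub>1 x\<^sub>r - q x\<^sub>r x\<^sub>r\<^sub>+\<^sub>1\<close>, which is a multiple of a translate of \<open>T\<^sub>0 e\<^sub>0\<close> under
  powers of \<open>\<sigma>\<close>, and of \<open>y\<^sub>s y\<^sub>s\<^sub>+\<^sub>1 - q y\<^sub>s\<^sub>+\<^sub>1 y\<^sub>s\<close>, which is one of a translate of \<open>e\<^sub>0\<close>. They come from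
  the string \<open>m\<^sub>0 = e\<^sub>0, m\<^sub>1, \<dots>, m\<^sub>4\<close> of iterated \<open>q\<close>-commutators with \<open>e\<^sub>1\<close>: up to scalars \<open>T\<^sub>1\<close> maps
  \<open>e\<^sub>0, y\<^sub>1, \<psi>\<^sub>1, x\<^sub>1\<close> to \<open>m\<^sub>4, m\<^sub>3, m\<^sub>2, m\<^sub>1\<close>, while \<open>T\<^sub>0\<close> maps \<open>m\<^sub>1, m\<^sub>2\<close> to \<open>e\<^sub>1, \<psi>\<^sub>1\<close>.
\<close>

section \<open>Quantum integers\<close>

lemma q1_eq_to_fract: "q1 = to_fract [:0, 1:]"
  by (simp add: q1_def to_fract_def)

text \<open>
  Elements of the ground field are shown to be nonzero by specialising \<open>q\<^sub>1\<close> to 2.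
\<close>

lemma to_fract_nonzero:
  assumes "poly P 2 \<noteq> 0"
  shows "to_fract P \<noteq> (0 :: qfield)"
  using assms by auto

lemma to_fract_power: "to_fract (P ^ n) = to_fract P ^ n"
  by (induction n) simp_all

lemma q1_power_neq_1:
  assumes "n > 0"
  shows "q1 ^ n \<noteq> 1"
proof -
  have "(2 :: rat) ^ n > 1"
    using assms by (intro one_less_power) simp_all
  then have "poly ([:0, 1:] ^ n - 1) (2 :: rat) \<noteq> 0"
    by simp
  from to_fract_nonzero[OF this] show ?thesis
    by (simp add: q1_eq_to_fract to_fract_power)
qed

lemma q1_nonzero [simp]: "q1 \<noteq> 0"
  by (simp add: q1_eq_to_fract)

lemma q_nonzero [simp]: "q \<noteq> 0"
  by (simp add: q_def)

lemma q1_minus_inverse_nonzero: "q1 - inverse q1 \<noteq> 0"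
  using q1_power_neq_1[of 2] by (simp add: field_simps power2_eq_square)

lemma qint_Node1:
  "qint Node1 1 = 1"
  "qint Node1 2 = q1 + inverse q1"
  "qint Node1 3 = q + 1 + inverse q"
  "qint Node1 4 = (q1 + inverse q1) * (q + inverse q)"
proof -
  note d = q1_minus_inverse_nonzero
  have "(q1 - inverse q1) * (q1 + inverse q1) = q1 ^ 2 - inverse q1 ^ 2"
    "(q1 - inverse q1) * (q + 1 + inverse q) = q1 ^ 3 - inverse q1 ^ 3"
    "(q1 - inverse q1) * ((q1 + inverse q1) * (q + inverse q)) = q1 ^ 4 - inverse q1 ^ 4"
    by (simp_all add: q_def field_simps eval_nat_numeral)
  with d show "qint Node1 1 = 1"
  "qint Node1 2 = q1 + inverse q1"
  "qint Node1 3 = q + 1 + inverse q"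
  "qint Node1 4 = (q1 + inverse q1) * (q + inverse q)"
    by (simp_all add: qint_def divide_eq_eq mult.commute)
qed

lemma qint_Node1_nonzero:
  "n > 0 \<Longrightarrow> qint Node1 n \<noteq> 0"
proof -
  assume "n > 0"
  have "q1 ^ n * q1 ^ n \<noteq> 1"
    using q1_power_neq_1[of "n + n"] \<open>n > 0\<close> by (simp add: power_add)
  then show ?thesis
    using q1_minus_inverse_nonzero by (simp add: qint_def field_simps power_inverse)
qed

lemma q2_nonzero: "q ^ 2 - inverse q ^ 2 \<noteq> 0"
  using q1_power_neq_1[of 8] by (simp add: q_def field_simps eval_nat_numeral)

lemma qint_Node0:
  "qint Node0 1 = 1"
  "qint Node0 2 = q ^ 2 + inverse q ^ 2"
  "q ^ 2 + inverse q ^ 2 \<noteq> 0"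
proof -
  have d: "q ^ 2 - inverse (q ^ 2) \<noteq> 0"
    using q2_nonzero by (simp add: power_inverse)
  then show "qint Node0 1 = 1"
    by (simp add: qint_def)
  have "(q ^ 2 + inverse q ^ 2) * (q ^ 2 - inverse (q ^ 2)) = (q ^ 2) ^ 2 - inverse (q ^ 2) ^ 2"
    by (simp add: algebra_simps power2_eq_square)
  with d show eq: "qint Node0 2 = q ^ 2 + inverse q ^ 2"
    by (simp add: qint_def divide_eq_eq)
  have "q ^ 8 \<noteq> 1"
    using q1_power_neq_1[of 16] by (simp add: q_def flip: power_mult)
  then show "q ^ 2 + inverse q ^ 2 \<noteq> 0"
    using d unfolding eq[symmetric] by (simp add: qint_def field_simps eval_nat_numeral)
qed

section \<open>The structure series and its logarithmic derivative\<close>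

definition linear_factor :: "'a::field \<Rightarrow> 'a fps" where
  "linear_factor a = 1 - fps_const a * fps_X"

text \<open>
  The factor \<open>X\<close> keeps degrees: the \<open>n\<close>-th coefficient of \<open>X f'\<close> is \<open>n\<close> times that of \<open>f\<close>, which is the weight
  with which arithmetic progressions enter below.
\<close>

definition log_deriv :: "'a::field fps \<Rightarrow> 'a fps" where
  "log_deriv f = fps_X * fps_deriv f / f"

lemma linear_factor_nth_0 [simp]: "fps_nth (linear_factor a) 0 = 1"
  by (simp add: linear_factor_def)

lemma log_deriv_mult:
  assumes "fps_nth f 0 \<noteq> 0" "fps_nth g 0 \<noteq> 0"
  shows "log_deriv (f * g) = log_deriv f + log_deriv g"
proof -
  have i: "inverse f * f = 1" "inverse g * g = 1"
    using assms by (simp_all add: inverse_mult_eq_1)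
  have "log_deriv (f * g) = fps_X * (fps_deriv f * (inverse g * g) * inverse f + fps_deriv g * (inverse f * f) * inverse g)"
    using assms by (simp add: log_deriv_def fps_divide_unit fps_inverse_mult algebra_simps)
  with i show ?thesis using assms by (simp add: log_deriv_def fps_divide_unit algebra_simps)
qed

lemma log_deriv_inverse:
  assumes "fps_nth f 0 \<noteq> 0"
  shows "log_deriv (inverse f) = - log_deriv f"
proof -
  have "log_deriv (inverse f) + log_deriv f = log_deriv (inverse f * f)"
    using assms by (simp add: log_deriv_mult)
  also have "\<dots> = 0"
    using assms by (simp add: inverse_mult_eq_1 log_deriv_def)
  finally show ?thesis by (simp add: eq_neg_iff_add_eq_0)
qed

lemma inverse_linear_factor: "inverse (linear_factor a) = Abs_fps (\<lambda>n. a ^ n)"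
proof -
  have "linear_factor a * Abs_fps (\<lambda>n. a ^ n) = 1"
  proof (rule fps_ext)
    fix n show "fps_nth (linear_factor a * Abs_fps (\<lambda>n. a ^ n)) n = fps_nth 1 n"
      by (cases n) (simp_all add: linear_factor_def algebra_simps)
  qed
  then show ?thesis by (simp add: fps_inverse_unique)
qed

lemma log_deriv_linear_factor_nth: "n > 0 \<Longrightarrow> fps_nth (log_deriv (linear_factor a)) n = - (a ^ n)"
proof -
  have "log_deriv (linear_factor a) = fps_const (- a) * (fps_X * Abs_fps (\<lambda>n. a ^ n))"
    by (simp add: log_deriv_def fps_divide_unit inverse_linear_factor) (simp add: linear_factor_def algebra_simps)
  then show "n > 0 \<Longrightarrow> ?thesis" by (cases n) simp_all
qed

text \<open>
  Denominator and numerator of the series \<open>g\<close> by which \<open>\<psi>(z)\<close> is moved past the root vectors \<open>x\<^sub>r\<close>.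
\<close>

definition g_plus where "g_plus = linear_factor (q ^ 2) * linear_factor (- inverse q)"
definition g_minus where "g_minus = linear_factor (inverse q ^ 2) * linear_factor (- q)"

lemma g_nth_0 [simp]: "fps_nth g_plus 0 = 1" "fps_nth g_minus 0 = 1"
  by (simp_all add: g_plus_def g_minus_def)

lemma log_deriv_g_ratio_nth:
  assumes "n > 0"
  shows "fps_nth (log_deriv (g_minus / g_plus)) n = q ^ (2 * n) - inverse q ^ (2 * n) + (- inverse q) ^ n - (- q) ^ n"
  using assms
  by (simp add: fps_divide_unit log_deriv_mult log_deriv_inverse g_plus_def g_minus_def log_deriv_linear_factor_nth power_mult
    fps_inverse_mult)

text \<open>
  The power \<open>q\<^sup>2\<^sup>n\<close> outweighs all the other terms; concretely, the value at \<open>q\<^sub>1 = 2\<close>, that is \<open>q = 4\<close>, is positive.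
  This is the factor that has to be cancelled in the induction step.
\<close>

lemma log_deriv_g_ratio_nondegenerate:
  assumes "n > 0"
  shows "fps_nth (log_deriv (g_minus / g_plus)) n + fps_nth (log_deriv (g_minus / g_plus)) 1 \<noteq> 0"
proof
  assume *: "fps_nth (log_deriv (g_minus / g_plus)) n + fps_nth (log_deriv (g_minus / g_plus)) 1 = 0"
  (* X stands for q, the square of the indeterminate; P is the sum in question with its
     denominators cleared by the power 2n+2 of q. *)
  let ?X = "[:0, 0, 1:] :: rat poly"
  define P where "P = ?X ^ 2 * (?X ^ (4 * n) - 1 + (-1) ^ n * (?X ^ n - ?X ^ (3 * n)))
     + ?X ^ (2 * n) * (?X ^ 4 - 1 + ?X ^ 3 - ?X)"
  have qX: "q = to_fract ?X"
    by (simp add: q_def q1_eq_to_fract power2_eq_square flip: to_fract_mult)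
  have "to_fract P = q ^ 2 * (q ^ (4 * n) - 1 + (-1) ^ n * (q ^ n - q ^ (3 * n)))
     + q ^ (2 * n) * (q ^ 4 - 1 + q ^ 3 - q)"
    by (simp add: P_def to_fract_power qX)
  also have "\<dots> = q ^ (2 * n + 2) * (fps_nth (log_deriv (g_minus / g_plus)) n + fps_nth (log_deriv (g_minus / g_plus)) 1)"
  proof -
    have a: "q ^ (4 * n) = (q ^ n) ^ 4" "q ^ (3 * n) = (q ^ n) ^ 3" "q ^ (2 * n) = (q ^ n) ^ 2"
      by (simp_all add: power_mult[symmetric] mult.commute)
    show ?thesis
      using assms
      by (simp add: log_deriv_g_ratio_nth power_minus[of q] power_minus[of "inverse q"] power_inverse power_add a)
        (simp add: field_simps eval_nat_numeral)
  qed
  finally have "to_fract P = 0" using * by simp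
  moreover have "poly P 2 \<noteq> 0"
  proof -
    define u :: rat where "u = 4 ^ n"
    have u: "u \<ge> 4"
      using power_increasing[of 1 n "4 :: rat"] assms by (simp add: u_def)
    have P: "poly P 2 = 16 * (u ^ 4 - 1 + (-1) ^ n * (u - u ^ 3)) + u ^ 2 * 315"
      by (simp add: P_def u_def power_mult[symmetric] mult.commute)
    have v: "u ^ 3 \<le> u ^ 4" "u \<le> u ^ 3" "16 \<le> u ^ 2"
      using u power_increasing[of 3 4 u] power_increasing[of 1 3 u] power_mono[of 4 u 2] by auto
    have "16 * a - 16 + (16 * u - 16 * b) + c * 315 > 0"
      "16 * a - 16 + (16 * b - 16 * u) + c * 315 > 0"
      if "b \<le> a" "u \<le> b" "16 \<le> c" for a b c :: rat
      using u that by linarith+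
    from this[OF v] show ?thesis
      by (cases "even n") (simp_all add: P algebra_simps)
  qed
  ultimately show False using to_fract_nonzero by blast
qed

section \<open>Power series in the shift operator\<close>

lemma sum_triangle_by_first:
  fixes F :: "nat \<Rightarrow> nat \<Rightarrow> 'a::comm_monoid_add"
  shows "(\<Sum>j\<le>n. \<Sum>i\<le>j. F i (j - i)) = (\<Sum>i\<le>n. \<Sum>j\<le>n - i. F i j)"
  unfolding sum.triangle_reindex_eq[symmetric]
  by (simp add: sum.Sigma) (rule sum.cong, auto)

text \<open>
  A family \<open>u n r\<close> stands for the generating series \<open>\<Sum>\<^sub>n u n r z\<^sup>n\<close>, and \<open>f\<close> acts on it as \<open>f(zS)\<close>, where \<open>S\<close>
  raises \<open>r\<close> by one. Since \<open>f(zS)\<close> involves only finitely many \<open>u m\<close> in each degree, relations known up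
  to some degree can be multiplied and inverted without any formal generating series.
\<close>

locale shift_space = vector_space scale for scale :: "'k::field \<Rightarrow> 'a::ab_group_add \<Rightarrow> 'a"
begin

definition shift_conv where
  "shift_conv f u n r = (\<Sum>j\<le>n. scale (fps_nth f j) (u (n - j) (r + int j)))"

lemma shift_conv_cong:
  assumes "\<And>m r. m \<le> n \<Longrightarrow> u m r = v m r"
  shows "shift_conv f u n r = shift_conv f v n r"
  using assms by (simp add: shift_conv_def)

lemma shift_conv_1 [simp]: "shift_conv 1 u = u"
proof (intro ext)
  fix n r
  have "shift_conv 1 u n r = (\<Sum>j\<le>n. if j = 0 then u n r else 0)"
    unfolding shift_conv_def by (intro sum.cong) auto
  then show "shift_conv 1 u n r = u n r" by simp
qed

lemma shift_conv_mult: "shift_conv (f * g) u = shift_conv f (shift_conv g u)"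
proof (intro ext)
  fix n r
  have "shift_conv (f * g) u n r =
    (\<Sum>j\<le>n. \<Sum>i\<le>j. scale (fps_nth f i * fps_nth g (j - i)) (u (n - j) (r + int j)))"
    by (simp add: shift_conv_def fps_mult_nth scale_sum_left atLeast0AtMost)
  also have "\<dots> = (\<Sum>i\<le>n. \<Sum>j\<le>n - i. scale (fps_nth f i * fps_nth g j) (u (n - i - j) (r + int i + int j)))"
    using sum_triangle_by_first[where n = n and
        F = "\<lambda>i j. scale (fps_nth f i * fps_nth g j) (u (n - i - j) (r + int i + int j))"]
    by simp
  also have "\<dots> = shift_conv f (shift_conv g u) n r"
    by (simp add: shift_conv_def scale_sum_right)
  finally show "shift_conv (f * g) u n r = shift_conv f (shift_conv g u) n r" .
qed

lemma shift_conv_linear_factor_Suc: "shift_conv (linear_factor a) u (Suc n) r = u (Suc n) r - scale a (u n (r + 1))"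
proof -
  have "(\<Sum>j\<le>n. scale (fps_nth (linear_factor a) (Suc j)) (u (n - j) (r + int (Suc j))))
    = (\<Sum>j\<le>n. if j = 0 then - scale a (u n (r + 1)) else 0)"
    by (intro sum.cong) (auto simp: linear_factor_def)
  then show ?thesis
    by (simp add: shift_conv_def sum.atMost_Suc_shift del: sum.atMost_Suc)
qed

lemma shift_conv_linear_factor_0: "shift_conv (linear_factor a) u 0 r = u 0 r"
  by (simp add: shift_conv_def)

end

section \<open>The exchange relation\<close>

text \<open>
  The structure constants: \<open>[\<psi>\<^sub>1, x\<^sub>r]\<close> is \<open>ad_coeff\<close> times \<open>x\<^sub>r\<^sub>+\<^sub>1\<close>, and the commutator of \<open>\<psi>\<^sub>1\<close> with
  \<open>x\<^sub>r\<^sub>+\<^sub>1 x\<^sub>r - q x\<^sub>r x\<^sub>r\<^sub>+\<^sub>1\<close> is \<open>quad_coeff\<close> times the square of \<open>x\<^sub>r\<^sub>+\<^sub>1\<close>.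
\<close>

definition ad_coeff where "ad_coeff = qint Node1 2 * qint Node1 3"
definition quad_coeff where "quad_coeff = qint Node1 4 * (q ^ 2 - inverse q)"

lemma ad_coeff_nonzero: "ad_coeff \<noteq> 0"
  by (simp add: ad_coeff_def qint_Node1_nonzero)

lemma ad_coeff_eq: "ad_coeff = inverse (q1 - inverse q1) * (q ^ 2 - inverse q ^ 2 - inverse q + q)"
proof -
  have "ad_coeff * (q1 - inverse q1) = q ^ 2 - inverse q ^ 2 - inverse q + q"
    unfolding ad_coeff_def qint_Node1 by (simp add: q_def field_simps power2_eq_square)
  then show ?thesis
    using q1_minus_inverse_nonzero by (simp add: field_simps)
qed

text \<open>
  The multiplication is a parameter, so that results about the family \<open>x\<close> can be applied to the family
  \<open>y\<close> in the opposite algebra: reversing the order of products and exchanging \<open>x\<close> with \<open>y\<close> preserves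
  the bracket \<open>y\<^sub>s x\<^sub>r - q\<^sup>-\<^sup>1 x\<^sub>r y\<^sub>s\<close>.
\<close>

locale assoc_algebra = shift_space scale
  for scale :: "qfield \<Rightarrow> 'a::ab_group_add \<Rightarrow> 'a" (infixr "\<cdot>" 75) +
  fixes mul :: "'a \<Rightarrow> 'a \<Rightarrow> 'a" (infixl "\<star>" 70)
  assumes mul_assoc: "(a \<star> b) \<star> c = a \<star> (b \<star> c)"
    and mul_add_left: "(a + b) \<star> c = a \<star> c + b \<star> c"
    and mul_add_right: "a \<star> (b + c) = a \<star> b + a \<star> c"
    and mul_scale_left: "(x \<cdot> a) \<star> b = x \<cdot> (a \<star> b)"
    and mul_scale_right: "a \<star> (x \<cdot> b) = x \<cdot> (a \<star> b)"
begin

lemma mul_diff_left: "(a - b) \<star> c = a \<star> c - b \<star> c"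
  using mul_add_left[of "a - b" b c] by (simp add: algebra_simps)

lemma mul_diff_right: "a \<star> (b - c) = a \<star> b - a \<star> c"
  using mul_add_right[of a "b - c" c] by (simp add: algebra_simps)

lemma mul_minus_left: "(- a) \<star> b = - (a \<star> b)"
  using mul_diff_left[of 0 a b] mul_diff_left[of 0 0 b] by simp

lemma mul_minus_right: "a \<star> (- b) = - (a \<star> b)"
  using mul_diff_right[of a 0 b] mul_diff_right[of a 0 0] by simp

lemma mul_zero: "0 \<star> a = 0" "a \<star> 0 = 0"
  using mul_diff_left[of 0 0 a] mul_diff_right[of a 0 0] by simp_all

lemmas mul_simps = mul_zero mul_minus_left mul_minus_right mul_assoc mul_add_left mul_add_right mul_diff_left mul_diff_right
  mul_scale_left mul_scale_right

definition comm :: "'a \<Rightarrow> 'a \<Rightarrow> 'a" where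
  "comm a b = a \<star> b - b \<star> a"

lemma comm_mul: "comm a (b \<star> c) = comm a b \<star> c + b \<star> comm a c"
  by (simp add: comm_def mul_simps)

lemma comm_scale: "comm a (x \<cdot> b) = x \<cdot> comm a b"
  by (simp add: comm_def mul_simps scale_right_diff_distrib)

lemma comm_add: "comm a (b + c) = comm a b + comm a c"
  by (simp add: comm_def mul_simps)

lemma comm_diff: "comm a (b - c) = comm a b - comm a c"
  by (simp add: comm_def mul_simps)

lemmas comm_simps = comm_mul comm_scale comm_add comm_diff

definition bracket where "bracket x y r t = y t \<star> x r - inverse q \<cdot> (x r \<star> y t)"

text \<open>
  For the family of root vectors of weight \<open>r\<delta> + \<alpha>\<^sub>1\<close> this is, up to a scalar, a root vector of weight
  \<open>(2r+1)\<delta> + 2\<alpha>\<^sub>1\<close>.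
\<close>

definition quad where "quad x r = x (r + 1) \<star> x r - q \<cdot> (x r \<star> x (r + 1))"

text \<open>
  Moving \<open>y\<^sub>t\<close> through the two factors of the quadratic element leaves two brackets, of degrees differing by one.
  This is where relations between consecutive \<open>\<psi>\<^sub>n\<close> originate.
\<close>

lemma bracket_quad:
  "y t \<star> quad x r - inverse q ^ 2 \<cdot> (quad x r \<star> y t) =
     bracket x y (r + 1) t \<star> x r - x r \<star> bracket x y (r + 1) t
       - q \<cdot> (bracket x y r t \<star> x (r + 1)) + inverse q \<cdot> (x (r + 1) \<star> bracket x y r t)"
  by (simp add: bracket_def quad_def mul_simps algebra_simps power2_eq_square)

text \<open>
  Let \<open>E\<^sub>n\<^sub>,\<^sub>r = [\<psi>\<^sub>n\<^sub>+\<^sub>1, x\<^sub>r] - q \<psi>\<^sub>n x\<^sub>r\<^sub>+\<^sub>1 + q\<^sup>-\<^sup>1 x\<^sub>r\<^sub>+\<^sub>1 \<psi>\<^sub>n\<close>. By \<open>bracket_quad\<close> it is the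
  \<open>q\<close>-commutator of \<open>y\<^sub>n\<^sub>-\<^sub>r\<close> with the quadratic element of index \<open>r\<close>. Now take the commutator with \<open>\<psi>\<^sub>1\<close> in two ways.
  By definition of \<open>E\<^sub>n\<^sub>,\<^sub>r\<close> it is \<open>ad_coeff\<close> times \<open>E\<^sub>n\<^sub>,\<^sub>r\<^sub>+\<^sub>1\<close>, as \<open>\<psi>\<^sub>1\<close> commutes with \<open>\<psi>\<^sub>n\<close> and \<open>\<psi>\<^sub>n\<^sub>+\<^sub>1\<close>; through the
  \<open>q\<close>-commutator it is \<open>- ad_coeff\<close> times \<open>E\<^sub>n\<^sub>+\<^sub>1\<^sub>,\<^sub>r\<close> plus a term with the square of \<open>x\<^sub>r\<^sub>+\<^sub>1\<close>, which reduces to brackets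
  of degree \<open>n + 1\<close>. The resulting three-term relation is the exchange relation in degree \<open>n + 2\<close>. The choice of \<open>\<psi>\<^sub>0\<close> makes
  the degrees 0 and 1 fit the same pattern.
\<close>

lemma exchange_relation:
  fixes x y :: "int \<Rightarrow> 'a" and \<psi> :: "nat \<Rightarrow> 'a" and one :: 'a
  assumes one: "\<And>a. one \<star> a = a" "\<And>a. a \<star> one = a"
    and psi_0: "\<psi> 0 = inverse (q1 - inverse q1) \<cdot> one"
    and ax: "\<And>r. comm (\<psi> (Suc 0)) (x r) = ad_coeff \<cdot> x (r + 1)"
    and ay: "\<And>t. comm (\<psi> (Suc 0)) (y t) = - (ad_coeff \<cdot> y (t + 1))"
    and az: "\<And>r. comm (\<psi> (Suc 0)) (quad x r) = quad_coeff \<cdot> (x (r + 1) \<star> x (r + 1))"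
    and base: "\<And>r. y (- r) \<star> quad x r - inverse q ^ 2 \<cdot> (quad x r \<star> y (- r)) = qint Node1 4 \<cdot> x (r + 1)"
    and inv: "\<And>r n. 1 \<le> n \<Longrightarrow> n \<le> N \<Longrightarrow> bracket x y r (int n - r) = \<psi> n"
    and le: "n \<le> N"
  shows "shift_conv g_plus (\<lambda>m r. \<psi> m \<star> x r) n r = shift_conv g_minus (\<lambda>m r. x r \<star> \<psi> m) n r"
proof -
  define E where "E n r = comm (\<psi> (Suc n)) (x r) - q \<cdot> (\<psi> n \<star> x (r + 1)) + inverse q \<cdot> (x (r + 1) \<star> \<psi> n)" for n r
  (* For n = 0 the second bracket has degree 0 and is not covered by the hypothesis inv; the normalisation
     of psi_0 makes base the same formula. *)
  have E_eq: "E n r = y (int n - r) \<star> quad x r - inverse q ^ 2 \<cdot> (quad x r \<star> y (int n - r))" if "n < N" for n r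
  proof (cases n)
    case 0
    have "E 0 r = (ad_coeff - (q - inverse q) / (q1 - inverse q1)) \<cdot> x (r + 1)"
      using ax[of r] by (simp add: E_def psi_0 mul_simps one algebra_simps divide_inverse)
    also have "ad_coeff - (q - inverse q) / (q1 - inverse q1) = qint Node1 4"
    proof -
      have "(q - inverse q) / (q1 - inverse q1) = q1 + inverse q1"
        using q1_minus_inverse_nonzero by (simp add: divide_eq_eq) (simp add: q_def field_simps power2_eq_square)
      then show ?thesis by (simp add: ad_coeff_def qint_Node1 algebra_simps)
    qed
    finally show ?thesis using 0 base[of r] by simp
  next
    case (Suc m)
    have "bracket x y (r + 1) (int n - r) = \<psi> (Suc n)" "bracket x y r (int n - r) = \<psi> n"
      using inv[of "Suc n" "r + 1"] inv[of n r] that Suc by (simp_all add: algebra_simps)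
    then show ?thesis
      by (simp only: bracket_quad) (simp add: E_def comm_def)
  qed
  have comm_psi: "comm (\<psi> (Suc 0)) (\<psi> m) = 0" if "m < N" for m
  proof (cases m)
    case 0
    then show ?thesis by (simp add: psi_0 comm_def mul_simps one)
  next
    case (Suc k)
    have *: "comm (\<psi> (Suc 0)) (bracket x y 0 (int m)) = ad_coeff \<cdot> bracket x y 1 (int m) - ad_coeff \<cdot> bracket x y 0 (int m + 1)"
      by (simp add: bracket_def comm_simps ax ay mul_simps) (simp add: algebra_simps)
    show ?thesis
      using * inv[of m 0] inv[of "Suc m" 1] inv[of "Suc m" 0] that Suc by (simp add: algebra_simps)
  qed
  have rec: "ad_coeff \<cdot> E n (r + 1) + ad_coeff \<cdot> E (Suc n) r
      = quad_coeff \<cdot> (\<psi> (Suc n) \<star> x (r + 1) + inverse q \<cdot> (x (r + 1) \<star> \<psi> (Suc n)))"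
    if "Suc n < N" for n r
  proof -
    have "ad_coeff \<cdot> E n (r + 1) = comm (\<psi> (Suc 0)) (E n r)"
      using comm_psi[of n] comm_psi[of "Suc n"] that
      by (simp add: E_def comm_simps ax) (simp add: comm_def[of "\<psi> (Suc n)"] comm_simps ax mul_simps algebra_simps)
    also have "\<dots> = quad_coeff \<cdot> (y (int n - r) \<star> (x (r + 1) \<star> x (r + 1)) - inverse q ^ 2 \<cdot> (x (r + 1) \<star> x (r + 1) \<star> y (int n - r)))
       - ad_coeff \<cdot> (y (int (Suc n) - r) \<star> quad x r - inverse q ^ 2 \<cdot> (quad x r \<star> y (int (Suc n) - r)))"
      using that by (simp add: E_eq comm_simps ay az mul_simps) (simp add: algebra_simps)
    also have "y (int (Suc n) - r) \<star> quad x r - inverse q ^ 2 \<cdot> (quad x r \<star> y (int (Suc n) - r)) = E (Suc n) r"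
      using that by (simp add: E_eq)
    also have "y (int n - r) \<star> (x (r + 1) \<star> x (r + 1)) - inverse q ^ 2 \<cdot> (x (r + 1) \<star> x (r + 1) \<star> y (int n - r))
      = bracket x y (r + 1) (int n - r) \<star> x (r + 1) + inverse q \<cdot> (x (r + 1) \<star> bracket x y (r + 1) (int n - r))"
      by (simp add: bracket_def mul_simps algebra_simps power2_eq_square)
    also have "bracket x y (r + 1) (int n - r) = \<psi> (Suc n)"
      using inv[of "Suc n" "r + 1"] that by simp
    finally show ?thesis by (simp add: algebra_simps)
  qed
  (* This quotient is what makes the quadratic polynomials factor as g_plus and g_minus. *)
  have quad_coeff: "quad_coeff = ad_coeff * (q ^ 2 - q + 1 - inverse q)"
    unfolding quad_coeff_def ad_coeff_def qint_Node1 by (simp add: field_simps power2_eq_square)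
  consider "n = 0" | "n = 1" | m where "n = Suc (Suc m)"
    by (metis One_nat_def not0_implies_Suc)
  then show ?thesis
  proof cases
    case 1
    then show ?thesis by (simp add: g_plus_def g_minus_def shift_conv_mult shift_conv_linear_factor_0 psi_0 mul_simps one)
  next
    case 2
    have "\<psi> (Suc 0) \<star> x r = x r \<star> \<psi> (Suc 0) + ad_coeff \<cdot> x (r + 1)"
      using ax[of r] by (simp add: comm_def algebra_simps)
    then show ?thesis unfolding 2 One_nat_def
      by (simp add: g_plus_def g_minus_def shift_conv_mult shift_conv_linear_factor_0 shift_conv_linear_factor_Suc psi_0 mul_simps one ad_coeff_eq)
        (simp add: algebra_simps)
  next
    case 3
    have "ad_coeff \<cdot> (E m (r + 1) + E (Suc m) r
      - (q ^ 2 - q + 1 - inverse q) \<cdot> (\<psi> (Suc m) \<star> x (r + 1) + inverse q \<cdot> (x (r + 1) \<star> \<psi> (Suc m)))) = 0"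
      using rec[of m r] 3 le quad_coeff by (simp add: scale_right_diff_distrib scale_right_distrib)
    with ad_coeff_nonzero have "E m (r + 1) + E (Suc m) r
      - (q ^ 2 - q + 1 - inverse q) \<cdot> (\<psi> (Suc m) \<star> x (r + 1) + inverse q \<cdot> (x (r + 1) \<star> \<psi> (Suc m))) = 0"
      by simp
    then show ?thesis unfolding 3
      by (simp add: g_plus_def g_minus_def shift_conv_mult shift_conv_linear_factor_Suc E_def comm_def algebra_simps power2_eq_square)
  qed
qed

end

section \<open>Invariance and commutativity\<close>

lemma (in shift_space) shift_conv_cancel:
  assumes "fps_nth f 0 \<noteq> 0" and eq: "\<And>m r. m \<le> n \<Longrightarrow> shift_conv f u m r = shift_conv g v m r"
  shows "u n r = shift_conv (g / f) v n r"
proof -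
  have "u n r = shift_conv (inverse f * f) u n r"
    using assms by (simp add: inverse_mult_eq_1)
  also have "\<dots> = shift_conv (inverse f) (shift_conv g v) n r"
    unfolding shift_conv_mult using eq by (rule shift_conv_cong)
  also have "\<dots> = shift_conv (g / f) v n r"
    using assms by (simp add: shift_conv_mult[symmetric] fps_divide_unit mult.commute)
  finally show ?thesis .
qed

lemma sum_triangle_by_second:
  fixes F :: "nat \<Rightarrow> nat \<Rightarrow> 'a::comm_monoid_add"
  shows "(\<Sum>i\<le>n. \<Sum>j\<le>n - i. F i j) = (\<Sum>m\<le>n. \<Sum>j\<le>m. F (m - j) j)"
proof -
  have "(\<Sum>j\<le>m. F (m - j) j) = (\<Sum>i\<le>m. F i (m - i))" for m
    by (rule sum.reindex_bij_witness[where i = "\<lambda>i. m - i" and j = "\<lambda>i. m - i"]) auto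
  then show ?thesis by (simp add: sum_triangle_by_first)
qed

definition g_ratio where "g_ratio = g_minus / g_plus"
definition g_ratio_inv where "g_ratio_inv = g_plus / g_minus"

lemma g_ratio: "g_ratio * g_ratio_inv = 1"
  by (simp add: g_ratio_def g_ratio_inv_def fps_divide_unit)
    (metis (no_types, lifting) g_nth_0 inverse_mult_eq_1 inverse_mult_eq_1' mult.commute mult.left_commute mult_1 zero_neq_one)

lemma sum_g_ratio: "(\<Sum>j\<le>m. fps_nth g_ratio j * fps_nth g_ratio_inv (m - j)) = (if m = 0 then 1 else 0)"
  using arg_cong[OF g_ratio, of "\<lambda>f. fps_nth f m"] by (simp add: fps_mult_nth atLeast0AtMost)

lemma sum_g_ratio_weighted:
  "(\<Sum>j\<le>m. of_nat j * (fps_nth g_ratio j * fps_nth g_ratio_inv (m - j))) = fps_nth (log_deriv g_ratio) m"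
proof -
  have "inverse g_ratio = g_ratio_inv"
    using g_ratio by (rule fps_inverse_unique)
  moreover have "fps_nth g_ratio 0 \<noteq> 0"
    by (simp add: g_ratio_def fps_divide_unit)
  ultimately have l: "log_deriv g_ratio = (fps_X * fps_deriv g_ratio) * g_ratio_inv"
    by (simp add: log_deriv_def fps_divide_unit)
  have XD: "fps_nth (fps_X * fps_deriv g_ratio) j = of_nat j * fps_nth g_ratio j" for j
    by (cases j) simp_all
  show ?thesis
    unfolding l by (subst fps_mult_nth) (simp only: XD atLeast0AtMost mult.assoc)
qed

text \<open>
  Agrees with the exchange relation in degree 1, where \<open>\<psi>\<^sub>1 x\<^sub>r\<close> exceeds \<open>x\<^sub>r \<psi>\<^sub>1\<close> by the linear coefficient of \<open>g\<close>
  times \<open>\<psi>\<^sub>0\<close>, and that coefficient is also the linear one of \<open>z g'(z) / g(z)\<close>.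
\<close>

lemma ad_coeff_log_deriv: "ad_coeff = fps_nth (log_deriv g_ratio) 1 * inverse (q1 - inverse q1)"
  using log_deriv_g_ratio_nth[of 1] by (simp add: g_ratio_def ad_coeff_eq)

context q_algebra
begin

sublocale shift_space scale ..

sublocale R: assoc_algebra scale "(*)"
  by unfold_locales (simp_all add: mult.assoc distrib_left distrib_right scale_mult_left scale_mult_right)

sublocale L: assoc_algebra scale "\<lambda>a b. b * a"
  by unfold_locales (simp_all add: mult.assoc distrib_left distrib_right scale_mult_left scale_mult_right)

end

text \<open>
  The relations of low degree from which commutativity follows. Interpretation \<open>R\<close> is the algebra itself
  and \<open>L\<close> its opposite; each assumption on \<open>y\<close> is the one on \<open>x\<close> read in the opposite algebra.
\<close>

locale loop_currents = q_algebra scale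
  for scale :: "qfield \<Rightarrow> 'a::ring_1 \<Rightarrow> 'a" +
  fixes x y :: "int \<Rightarrow> 'a" and \<psi> :: "nat \<Rightarrow> 'a"
  assumes psi_0: "\<psi> 0 = scale (inverse (q1 - inverse q1)) 1"
    and psi_Suc: "\<psi> (Suc n) = R.bracket x y (int n) 1"
    and psi_1: "R.bracket x y r (1 - r) = \<psi> (Suc 0)"
    and ad_x: "R.comm (\<psi> (Suc 0)) (x r) = scale ad_coeff (x (r + 1))"
    and ad_y: "L.comm (\<psi> (Suc 0)) (y r) = scale ad_coeff (y (r + 1))"
    and ad_quad_x: "R.comm (\<psi> (Suc 0)) (R.quad x r) = scale quad_coeff (x (r + 1) * x (r + 1))"
    and ad_quad_y: "L.comm (\<psi> (Suc 0)) (L.quad y r) = scale quad_coeff (y (r + 1) * y (r + 1))"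
    and lower_x: "y (- r) * R.quad x r - scale (inverse q ^ 2) (R.quad x r * y (- r)) = scale (qint Node1 4) (x (r + 1))"
    and lower_y: "L.quad y r * x (- r) - scale (inverse q ^ 2) (x (- r) * L.quad y r) = scale (qint Node1 4) (y (r + 1))"
begin

definition invariant_upto where
  "invariant_upto N \<longleftrightarrow> (\<forall>n r. 1 \<le> n \<longrightarrow> n \<le> N \<longrightarrow> R.bracket x y r (int n - r) = \<psi> n)"

lemma bracket_flip: "L.bracket y x r t = R.bracket x y t r"
  by (simp add: L.bracket_def R.bracket_def)

lemma comm_flip: "L.comm a b = - R.comm a b"
  by (simp add: L.comm_def R.comm_def)

lemma psi_x:
  assumes "invariant_upto N" "n \<le> N"
  shows "\<psi> n * x r = shift_conv g_ratio (\<lambda>m r. x r * \<psi> m) n r"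
  unfolding g_ratio_def
proof (rule shift_conv_cancel)
  fix m r assume "m \<le> n"
  show "shift_conv g_plus (\<lambda>m r. \<psi> m * x r) m r = shift_conv g_minus (\<lambda>m r. x r * \<psi> m) m r"
  proof (rule R.exchange_relation[where one = 1 and y = y and N = N])
    show "R.comm (\<psi> (Suc 0)) (y t) = - scale ad_coeff (y (t + 1))" for t
      using ad_y[of t] by (simp add: comm_flip minus_equation_iff)
    show "m \<le> N" using \<open>m \<le> n\<close> assms by simp
  qed (use assms in \<open>simp_all add: psi_0 ad_x ad_quad_x lower_x invariant_upto_def\<close>)
qed simp

lemma psi_y:
  assumes "invariant_upto N" "n \<le> N"
  shows "\<psi> n * y r = shift_conv g_ratio_inv (\<lambda>m r. y r * \<psi> m) n r"
  unfolding g_ratio_inv_def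
proof (rule shift_conv_cancel)
  fix m r assume "m \<le> n"
  have "shift_conv g_plus (\<lambda>m r. y r * \<psi> m) m r = shift_conv g_minus (\<lambda>m r. \<psi> m * y r) m r"
  proof (rule L.exchange_relation[where one = 1 and y = x and N = N])
    show "L.comm (\<psi> (Suc 0)) (x t) = - scale ad_coeff (x (t + 1))" for t
      using ad_x[of t] by (simp add: comm_flip)
    show "m \<le> N" using \<open>m \<le> n\<close> assms by simp
    show "L.bracket y x r (int n - r) = \<psi> n" if "1 \<le> n" "n \<le> N" for n r
      using assms(1) that unfolding invariant_upto_def bracket_flip
      by (metis add.commute diff_add_cancel diff_diff_eq2 add_diff_cancel_left')
  qed (simp_all add: psi_0 ad_y ad_quad_y lower_y)
  then show "shift_conv g_minus (\<lambda>m r. \<psi> m * y r) m r = shift_conv g_plus (\<lambda>m r. y r * \<psi> m) m r" ..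
qed simp

text \<open>
  Moving \<open>\<psi>\<^sub>n\<close> past both factors of a bracket: the factor \<open>x\<close> contributes a coefficient of \<open>g\<close> and the factor \<open>y\<close>
  one of \<open>1/g\<close>, in either order of the two factors, and \<open>m\<close> is the total shift.
\<close>

lemma psi_bracket:
  assumes "invariant_upto N" "n \<le> N"
  shows "\<psi> n * R.bracket x y r t = (\<Sum>m\<le>n. (\<Sum>j\<le>m. scale (fps_nth g_ratio j * fps_nth g_ratio_inv (m - j))
           (R.bracket x y (r + int j) (t + int (m - j)))) * \<psi> (n - m))"
proof -
  note px = psi_x[OF assms(1)] and py = psi_y[OF assms(1)]
  have 1: "\<psi> n * (y t * x r) = (\<Sum>m\<le>n. \<Sum>j\<le>m. scale (fps_nth g_ratio j * fps_nth g_ratio_inv (m - j))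
    (y (t + int (m - j)) * x (r + int j) * \<psi> (n - m)))"
  proof -
    have "\<psi> n * (y t * x r) = (\<psi> n * y t) * x r" by (simp add: mult.assoc)
    also have "\<dots> = (\<Sum>i\<le>n. scale (fps_nth g_ratio_inv i) (y (t + int i) * (\<psi> (n - i) * x r)))"
      using assms(2) by (simp add: py shift_conv_def sum_distrib_right scale_mult_left mult.assoc)
    also have "\<dots> = (\<Sum>i\<le>n. \<Sum>j\<le>n - i. scale (fps_nth g_ratio j * fps_nth g_ratio_inv i) (y (t + int i) * x (r + int j) * \<psi> (n - i - j)))"
      using assms(2) by (simp add: px shift_conv_def sum_distrib_left scale_mult_right mult.assoc scale_sum_right mult.commute[of "fps_nth g_ratio _"])
    finally show ?thesis by (simp add: sum_triangle_by_second)
  qed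
  have 2: "\<psi> n * (x r * y t) = (\<Sum>m\<le>n. \<Sum>j\<le>m. scale (fps_nth g_ratio j * fps_nth g_ratio_inv (m - j))
    (x (r + int j) * y (t + int (m - j)) * \<psi> (n - m)))"
  proof -
    have "\<psi> n * (x r * y t) = (\<psi> n * x r) * y t" by (simp add: mult.assoc)
    also have "\<dots> = (\<Sum>j\<le>n. scale (fps_nth g_ratio j) (x (r + int j) * (\<psi> (n - j) * y t)))"
      using assms(2) by (simp add: px shift_conv_def sum_distrib_right scale_mult_left mult.assoc)
    also have "\<dots> = (\<Sum>j\<le>n. \<Sum>i\<le>n - j. scale (fps_nth g_ratio j * fps_nth g_ratio_inv i) (x (r + int j) * y (t + int i) * \<psi> (n - j - i)))"
      using assms(2) by (simp add: py shift_conv_def sum_distrib_left scale_mult_right mult.assoc scale_sum_right)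
    finally show ?thesis by (simp add: sum_triangle_by_first[symmetric])
  qed
  show ?thesis
    by (simp add: R.bracket_def right_diff_distrib scale_mult_right 1 2 sum_distrib_right left_diff_distrib
        scale_mult_left scale_right_diff_distrib sum_subtractf scale_sum_right mult.commute)
qed

text \<open>
  When the brackets of a given total shift agree, their coefficients add up to those of \<open>g \<cdot> 1/g = 1\<close>.
\<close>

lemma psi_bracket_constant:
  assumes "invariant_upto N" "n \<le> N"
    and "\<And>m j. j \<le> m \<Longrightarrow> m \<le> n \<Longrightarrow> R.bracket x y (r + int j) (t + int (m - j)) = v m"
  shows "\<psi> n * R.bracket x y r t = v 0 * \<psi> n"
proof -
  have "\<psi> n * R.bracket x y r t = (\<Sum>m\<le>n. scale (\<Sum>j\<le>m. fps_nth g_ratio j * fps_nth g_ratio_inv (m - j)) (v m) * \<psi> (n - m))"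
    using assms by (simp add: psi_bracket scale_sum_left)
  also have "\<dots> = (\<Sum>m\<le>n. if m = 0 then v 0 * \<psi> n else 0)"
    unfolding sum_g_ratio by (rule sum.cong) auto
  finally show ?thesis by simp
qed

text \<open>
  The commutator of \<open>\<psi>\<^sub>1\<close> and \<open>\<psi>\<^sub>N\<close> is computed twice: from the action of \<open>\<psi>\<^sub>1\<close> on the bracket of degree \<open>N\<close>, and from
  the exchange relation of \<open>\<psi>\<^sub>N\<close> with the bracket \<open>\<psi>\<^sub>1\<close>. The two multiples of the obstruction \<open>D\<close> differ.
\<close>

lemma invariant_step:
  assumes inv: "invariant_upto N" and "N > 0"
  shows "invariant_upto (Suc N)"
proof -
  have inv': "R.bracket x y r (int n - r) = \<psi> n" if "1 \<le> n" "n \<le> N" for n r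
    using inv that by (simp add: invariant_upto_def)
  (* By diff_D below, the same difference is obtained at every other index r. *)
  define D where "D = R.bracket x y 1 (int N) - R.bracket x y 0 (int N + 1)"
  have cD: "R.comm (\<psi> (Suc 0)) (\<psi> N) = scale ad_coeff (R.bracket x y (r + 1) (int N - r) - R.bracket x y r (int N + 1 - r))" for r
  proof -
    have "R.comm (\<psi> (Suc 0)) (R.bracket x y r (int N - r))
        = scale ad_coeff (R.bracket x y (r + 1) (int N - r) - R.bracket x y r (int N - r + 1))"
    proof -
      have "R.comm (\<psi> (Suc 0)) (y t) = - scale ad_coeff (y (t + 1))" for t
        using ad_y[of t] by (simp add: comm_flip minus_equation_iff)
      then show ?thesis
        by (simp add: R.bracket_def R.comm_simps ad_x R.mul_simps) (simp add: algebra_simps)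
    qed
    moreover have "int N - r + 1 = int N + 1 - r" by simp
    ultimately show ?thesis using inv'[of N r] \<open>N > 0\<close> by (simp add: Suc_leI)
  qed
  have diff_D: "R.bracket x y (r + 1) (int N - r) - R.bracket x y r (int N + 1 - r) = D" for r
  proof -
    have "scale ad_coeff (R.bracket x y (r + 1) (int N - r) - R.bracket x y r (int N + 1 - r)) = scale ad_coeff D"
      using cD[of r, symmetric] cD[of 0] by (simp add: D_def del: scale_cancel_left)
    with ad_coeff_nonzero show ?thesis by simp
  qed
  have arith: "R.bracket x y (int j) (int N + 1 - int j) = R.bracket x y 0 (int N + 1) + scale (of_nat j) D" for j
  proof (induction j)
    case (Suc j)
    have "R.bracket x y (int (Suc j)) (int N + 1 - int (Suc j)) = R.bracket x y (int j) (int N + 1 - int j) + D"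
      using diff_D[of "int j"] by (simp add: algebra_simps)
    also have "\<dots> = R.bracket x y 0 (int N + 1) + scale (of_nat j) D + D"
      by (simp only: Suc)
    finally show ?case
      by (simp add: scale_left_distrib add_ac)
  qed simp
  let ?L = "fps_nth (log_deriv g_ratio) N"
  have "\<psi> N * \<psi> (Suc 0) = \<psi> (Suc 0) * \<psi> N + scale ?L D * \<psi> 0"
  proof -
    (* Only the extreme shifts survive: m = 0 gives the product in the opposite order, and for m = N the constant
       part of the arithmetic progression cancels. *)
    define F where "F m = (\<Sum>j\<le>m. scale (fps_nth g_ratio j * fps_nth g_ratio_inv (m - j)) (R.bracket x y (int j) (1 + int (m - j)))) * \<psi> (N - m)" for m
    have "F N = scale ?L D * \<psi> 0"
    proof -
      have "(\<Sum>j\<le>N. scale (fps_nth g_ratio j * fps_nth g_ratio_inv (N - j)) (R.bracket x y (int j) (1 + int (N - j))))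
         = (\<Sum>j\<le>N. scale (fps_nth g_ratio j * fps_nth g_ratio_inv (N - j)) (R.bracket x y 0 (int N + 1))
              + scale (of_nat j * (fps_nth g_ratio j * fps_nth g_ratio_inv (N - j))) D)"
      proof (rule sum.cong)
        fix j assume "j \<in> {..N}"
        then have e: "1 + int (N - j) = int N + 1 - int j"
          by (simp add: of_nat_diff)
        show "scale (fps_nth g_ratio j * fps_nth g_ratio_inv (N - j)) (R.bracket x y (int j) (1 + int (N - j)))
          = scale (fps_nth g_ratio j * fps_nth g_ratio_inv (N - j)) (R.bracket x y 0 (int N + 1))
              + scale (of_nat j * (fps_nth g_ratio j * fps_nth g_ratio_inv (N - j))) D"
          unfolding e arith by (simp add: scale_right_distrib mult_ac)
      qed simp
      also have "\<dots> = scale ?L D"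
        using \<open>N > 0\<close> by (simp add: sum.distrib sum_g_ratio sum_g_ratio_weighted flip: scale_sum_left)
      finally show ?thesis by (simp add: F_def)
    qed
    moreover have "F m = (if m = 0 then \<psi> (Suc 0) * \<psi> N else 0)" if "m < N" for m
    proof -
      have "R.bracket x y (int j) (1 + int (m - j)) = \<psi> (Suc m)" if "j \<le> m" for j
        using inv'[of "Suc m" "int j"] that \<open>m < N\<close> by (simp add: of_nat_diff algebra_simps)
      then have "F m = scale (\<Sum>j\<le>m. fps_nth g_ratio j * fps_nth g_ratio_inv (m - j)) (\<psi> (Suc m)) * \<psi> (N - m)"
        by (simp add: F_def scale_sum_left)
      then show ?thesis unfolding sum_g_ratio by simp
    qed
    moreover have "\<psi> N * \<psi> (Suc 0) = (\<Sum>m\<le>N. F m)"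
      using psi_bracket[OF inv order.refl, of 0 1] psi_1[of 0] by (simp add: F_def)
    moreover have "(\<Sum>m\<le>N. F m) = (\<Sum>m<N. F m) + F N"
      by (simp add: lessThan_Suc_atMost[symmetric])
    ultimately show ?thesis
      using \<open>N > 0\<close> by simp
  qed
  moreover have "\<psi> (Suc 0) * \<psi> N - \<psi> N * \<psi> (Suc 0) = scale ad_coeff D"
    using cD[of 0] by (simp add: R.comm_def D_def)
  ultimately have "scale ad_coeff D = - (scale ?L D * \<psi> 0)"
    by simp
  then have "scale ad_coeff D + scale ?L D * \<psi> 0 = 0"
    by simp
  then have "scale (inverse (q1 - inverse q1) * (?L + fps_nth (log_deriv g_ratio) 1)) D = 0"
    by (simp add: psi_0 scale_mult_left scale_mult_right ad_coeff_log_deriv algebra_simps)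
  moreover have "?L + fps_nth (log_deriv g_ratio) 1 \<noteq> 0"
    using log_deriv_g_ratio_nondegenerate[OF \<open>N > 0\<close>] by (simp add: g_ratio_def)
  ultimately have "D = 0"
    using q1_minus_inverse_nonzero by simp
  have shift: "R.bracket x y (r + 1) (int N + 1 - (r + 1)) = R.bracket x y r (int N + 1 - r)" for r
    using diff_D[of r] \<open>D = 0\<close> by simp
  have "R.bracket x y r (int N + 1 - r) = R.bracket x y (int N) 1" for r
  proof -
    have "R.bracket x y r (int N + 1 - r) = R.bracket x y 0 (int N + 1 - 0)" for r
    proof (induction r rule: int_induct[where k = 0])
      case (step1 i)
      then show ?case using shift[of i] by simp
    next
      case (step2 i)
      then show ?case using shift[of "i - 1"] by simp
    qed simp
    from this[of r] this[of "int N"] show ?thesis by simp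
  qed
  then show ?thesis
    using inv' by (auto simp: invariant_upto_def psi_Suc le_Suc_eq add.commute)
qed

lemma invariant: "invariant_upto N"
proof (induction N)
  case 0
  show ?case by (simp add: invariant_upto_def)
next
  case (Suc N)
  show ?case
  proof (cases "N = 0")
    case True
    have "n = 1" if "1 \<le> n" "n \<le> Suc 0" for n using that by simp
    then show ?thesis
      using psi_1 True by (auto simp: invariant_upto_def)
  next
    case False
    with Suc show ?thesis by (simp add: invariant_step)
  qed
qed

lemma bracket_eq: "n \<ge> 1 \<Longrightarrow> R.bracket x y r (int n - r) = \<psi> n"
  using invariant[of n] by (simp add: invariant_upto_def)

theorem psi_commute: "\<psi> k * \<psi> l = \<psi> l * \<psi> k"
proof (cases l)
  case 0
  then show ?thesis by (simp add: psi_0 scale_mult_left scale_mult_right)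
next
  case (Suc n)
  have "R.bracket x y (int n + int j) (1 + int (m - j)) = \<psi> (Suc n + m)" if "j \<le> m" for j m
  proof -
    have "1 + int (m - j) = int (Suc n + m) - (int n + int j)"
      using that by (simp add: of_nat_diff)
    then show ?thesis
      using bracket_eq[of "Suc n + m" "int n + int j"] by (simp only:)
  qed
  from psi_bracket_constant[OF invariant order.refl this, of k] show ?thesis
    using Suc by (simp add: psi_Suc)
qed

end

section \<open>Relations of low degree\<close>

context q_algebra
begin

text \<open>
  The lowering operation along a string of \<open>q\<close>-commutators with \<open>e\<close>, as for highest weight modules of
  \<open>sl\<^sub>2\<close>: here \<open>F = T e = - f K\<close>, \<open>u\<close> and \<open>m\<close> are consecutive members of the string, \<open>v\<close> precedes \<open>u\<close>, and \<open>l\<close> is the \<open>K\<close>-weight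
  of \<open>u\<close>. At the start of a string \<open>b = 0\<close>, whence the form of the assumption on \<open>v\<close>.
\<close>

lemma chain_step:
  assumes eF: "e * F = scale (inverse a) (F * e) + scale (inverse d) (1 - K * K)"
    and Ke: "K * e = scale a (e * K)" and Ku: "K * u = scale l (u * K)"
    and uF: "u * F = scale (inverse l) (F * u) + scale b v"
    and v: "scale b u = scale b (e * v - scale (l * inverse a) (v * e))"
    and nz: "a \<noteq> 0" "l \<noteq> 0"
    and m: "m = e * u - scale l (u * e)"
  shows "K * m = scale (l * a) (m * K)"
    and "m * F = scale (inverse (l * a)) (F * m) + scale (b + (inverse l - l) / d) u"
proof -
  have eF': "e * (F * z) = scale (inverse a) (F * (e * z)) + scale (inverse d) (z - K * (K * z))" for z
    using arg_cong[OF eF, of "\<lambda>t. t * z"] by (simp add: algebra_simps scale_mult_left)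
  have uF': "u * (F * z) = scale (inverse l) (F * (u * z)) + scale b (v * z)" for z
    using arg_cong[OF uF, of "\<lambda>t. t * z"] by (simp add: algebra_simps scale_mult_left)
  have Ke': "K * (e * z) = scale a (e * (K * z))" and Ku': "K * (u * z) = scale l (u * (K * z))" for z
    using arg_cong[OF Ke, of "\<lambda>t. t * z"] arg_cong[OF Ku, of "\<lambda>t. t * z"]
    by (simp_all add: mult.assoc scale_mult_left)
  show "K * m = scale (l * a) (m * K)"
    by (simp add: m algebra_simps scale_mult_left scale_mult_right Ke Ku Ke' Ku')
  have b: "scale b (e * v) = scale b u + scale (b * l * inverse a) (v * e)"
    using v by (simp add: scale_right_diff_distrib mult_ac)
  show "m * F = scale (inverse (l * a)) (F * m) + scale (b + (inverse l - l) / d) u"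
    using nz
    by (simp add: m algebra_simps scale_mult_left scale_mult_right eF uF eF' uF' Ku Ku' b divide_inverse)
qed

lemma iterated_commutator_4:
  assumes "u1 = e * u0 - scale a (u0 * e)" "u2 = e * u1 - scale b (u1 * e)"
    "u3 = e * u2 - scale c (u2 * e)" "u4 = e * u3 - scale d (u3 * e)"
  shows "u4 = e ^ 4 * u0 - scale (a + b + c + d) (e ^ 3 * u0 * e)
     + scale (a * b + a * c + a * d + b * c + b * d + c * d) (e ^ 2 * u0 * e ^ 2)
     - scale (a * b * c + a * b * d + a * c * d + b * c * d) (e * u0 * e ^ 3)
     + scale (a * b * c * d) (u0 * e ^ 4)"
  by (simp add: assms algebra_simps scale_mult_left scale_mult_right eval_nat_numeral)

end

lemma alg_hom_simps:
  assumes "alg_hom s1 s2 T"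
  shows "T (x + y) = T x + T y" "T (x - y) = T x - T y" "T (- x) = - T x" "T 0 = 0"
    "T (s1 c x) = s2 c (T x)" "T (x * y) = T x * T y" "T 1 = 1"
proof -
  interpret Vector_Spaces.linear s1 s2 T using assms by (simp add: alg_hom_def)
  show "T (x + y) = T x + T y" "T (x - y) = T x - T y" "T (- x) = - T x" "T 0 = 0"
    "T (s1 c x) = s2 c (T x)" "T (x * y) = T x * T y" "T 1 = 1"
    using assms by (simp_all add: add diff neg zero scale alg_hom_def)
qed

lemma bij_orbit:
  assumes "bij (f :: 'a \<Rightarrow> 'a)"
  obtains X :: "int \<Rightarrow> 'a" where "X 0 = a" "\<And>r. f (X r) = X (r - 1)" "\<And>n. X (int n) = (inv f ^^ n) a"
proof
  define X where "X r = (if r \<ge> 0 then (inv f ^^ nat r) a else (f ^^ nat (- r)) a)" for r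
  show "X 0 = a" "X (int n) = (inv f ^^ n) a" for n by (simp_all add: X_def)
  show "f (X r) = X (r - 1)" for r
  proof (cases "r > 0")
    case True
    then have "nat r = Suc (nat (r - 1))" by simp
    with True show ?thesis using assms by (simp add: X_def bij_is_surj surj_f_inv_f)
  next
    case False
    then have "nat (- (r - 1)) = Suc (nat (- r))" by simp
    with False show ?thesis by (cases "r = 0") (simp_all add: X_def)
  qed
qed

text \<open>
  Families moved along one step by \<open>f\<close> agree as soon as they agree at one index. Thus every relation between the root
  vectors has to be verified at a single, convenient index.
\<close>

lemma shift_eq:
  fixes A B :: "int \<Rightarrow> 'a"
  assumes "inj f" "\<And>r. f (A r) = A (r - 1)" "\<And>r. f (B r) = B (r - 1)" "A k = B k"
  shows "A r = B r"
proof (induction r rule: int_induct[where k = k])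
  case (step1 i)
  have "f (A (i + 1)) = f (B (i + 1))" using step1 assms(2,3)[of "i + 1"] by simp
  with \<open>inj f\<close> show ?case by (rule injD)
next
  case (step2 i)
  then show ?case using assms(2,3)[of i] by metis
qed fact

text \<open>
  The consequences of the defining relations that enter the proof. The elements \<open>k0'\<close> and \<open>k1'\<close> are the inverses of \<open>k0\<close>
  and \<open>k1\<close>, and \<open>serre_0\<close> is the Serre relation that is quadratic in \<open>e0\<close>, with denominators cleared.
\<close>

locale braided = q_algebra scale
  for scale :: "qfield \<Rightarrow> 'a::ring_1 \<Rightarrow> 'a" +
  fixes e0 e1 f0 f1 k0 k1 k0' k1' :: 'a and T0 T1 :: "'a \<Rightarrow> 'a"
  assumes k_inverse: "k0' * k0 = 1" "k1' * k1 = 1"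
    and k_e: "k0 * e0 = scale (q ^ 4) (e0 * k0)" "k0 * e1 = scale (inverse q ^ 2) (e1 * k0)"
      "k1 * e0 = scale (inverse q ^ 2) (e0 * k1)" "k1 * e1 = scale q (e1 * k1)"
    and e_f: "e0 * f0 = f0 * e0 + scale (inverse (q ^ 2 - inverse q ^ 2)) (k0 - k0')"
      "e1 * f1 = f1 * e1 + scale (inverse (q1 - inverse q1)) (k1 - k1')"
      "e0 * f1 = f1 * e0" "e1 * f0 = f0 * e1"
    and serre_0: "e0 * e0 * e1 + e1 * e0 * e0 = scale (q ^ 2 + inverse q ^ 2) (e0 * e1 * e0)"
    and T_hom: "alg_hom scale scale T0" "alg_hom scale scale T1"
    and T_bij: "bij T0" "bij T1"
    and T0_e0: "T0 e0 = - (f0 * k0)"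
    and T1_e1: "T1 e1 = - (f1 * k1)"
    and T0_e1: "T0 e1 = e0 * e1 - scale (inverse q ^ 2) (e1 * e0)"
    and T1_e0: "T1 e0 = (\<Sum>r\<le>4. scale ((- 1) ^ r * inverse q1 ^ r)
        (divpow scale Node1 e1 (4 - r) * e0 * divpow scale Node1 e1 r))"
begin

definition F0 where "F0 = T0 e0"
definition F1 where "F1 = T1 e1"
definition y1 where "y1 = T0 e1"
definition m1 where "m1 = e1 * e0 - scale (inverse q ^ 2) (e0 * e1)"
definition m2 where "m2 = e1 * m1 - scale (inverse q) (m1 * e1)"
definition m3 where "m3 = e1 * m2 - m2 * e1"
definition m4 where "m4 = e1 * m3 - scale q (m3 * e1)"
definition psi1 where "psi1 = y1 * e1 - scale (inverse q) (e1 * y1)"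
definition \<sigma> where "\<sigma> = T0 \<circ> T1"

lemmas T_simps = alg_hom_simps[OF T_hom(1)] alg_hom_simps[OF T_hom(2)]

lemma y1_eq: "y1 = e0 * e1 - scale (inverse q ^ 2) (e1 * e0)"
  by (simp add: y1_def T0_e1)

lemma e_F:
  "e0 * F0 = scale (inverse (q ^ 4)) (F0 * e0) + scale (inverse (q ^ 2 - inverse q ^ 2)) (1 - k0 * k0)"
  "e1 * F1 = scale (inverse q) (F1 * e1) + scale (inverse (q1 - inverse q1)) (1 - k1 * k1)"
  "e1 * F0 = scale (q ^ 2) (F0 * e1)"
  "e0 * F1 = scale (q ^ 2) (F1 * e0)"
proof -
  have swap: "e0 * k0 = scale (inverse (q ^ 4)) (k0 * e0)" "e1 * k0 = scale (q ^ 2) (k0 * e1)"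
    "e0 * k1 = scale (q ^ 2) (k1 * e0)" "e1 * k1 = scale (inverse q) (k1 * e1)"
    by (simp_all add: k_e power_inverse)
  have ef: "e0 * (f0 * z) = f0 * (e0 * z) + scale (inverse (q ^ 2 - inverse q ^ 2)) (k0 * z - k0' * z)"
      "e1 * (f1 * z) = f1 * (e1 * z) + scale (inverse (q1 - inverse q1)) (k1 * z - k1' * z)"
      "e0 * (f1 * z) = f1 * (e0 * z)" "e1 * (f0 * z) = f0 * (e1 * z)" for z
    by (simp_all add: mult.assoc[symmetric] e_f) (simp_all add: algebra_simps scale_mult_left)
  show "e0 * F0 = scale (inverse (q ^ 4)) (F0 * e0) + scale (inverse (q ^ 2 - inverse q ^ 2)) (1 - k0 * k0)"
    "e1 * F1 = scale (inverse q) (F1 * e1) + scale (inverse (q1 - inverse q1)) (1 - k1 * k1)"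
    "e1 * F0 = scale (q ^ 2) (F0 * e1)"
    "e0 * F1 = scale (q ^ 2) (F1 * e0)"
    by (simp_all only: F0_def F1_def T0_e0 T1_e1 mult_minus_left mult_minus_right ef swap k_inverse mult.assoc
         scale_mult_right) (simp_all add: scale_right_diff_distrib)
qed

text \<open>
  In the string of \<open>q\<close>-commutators with \<open>e0\<close> that starts at \<open>e1\<close>, the first step up is \<open>y1\<close>, and \<open>F0\<close> lowers it back.
\<close>

lemma y1_F0: "y1 * F0 = scale (inverse q ^ 2) (F0 * y1) + e1"
  using chain_step(2)[OF e_F(1) k_e(1) k_e(2), of 0 0 y1] q2_nonzero e_F(3) y1_eq
  by (simp add: power_inverse)  (simp add: field_simps eval_nat_numeral)

text \<open>
  The string starts at \<open>e0\<close>, which has \<open>k1\<close>-weight \<open>q\<^sup>-\<^sup>2\<close>, and each step multiplies the weight by \<open>q\<close>.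
\<close>

lemma chain:
  "m1 * F1 = scale q (F1 * m1) + scale (qint Node1 4) e0"
  "m2 * F1 = F1 * m2 + scale ad_coeff m1"
  "m3 * F1 = scale (inverse q) (F1 * m3) + scale ad_coeff m2"
  "m4 * F1 = scale (inverse q ^ 2) (F1 * m4) + scale (qint Node1 4) m3"
proof -
  note step = chain_step[OF e_F(2) k_e(4)]
  have br: "(q ^ 2 - inverse q ^ 2) / (q1 - inverse q1) = qint Node1 4"
    "qint Node1 4 + (q - inverse q) / (q1 - inverse q1) = ad_coeff"
    "ad_coeff + (inverse q - q) / (q1 - inverse q1) = qint Node1 4"
  proof -
    have 1: "(q ^ 2 - inverse q ^ 2) = qint Node1 4 * (q1 - inverse q1)"
      "(q - inverse q) = (ad_coeff - qint Node1 4) * (q1 - inverse q1)"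
      unfolding ad_coeff_def qint_Node1 by (simp_all add: q_def field_simps power2_eq_square)
    have 2: "inverse q - q = - (q - inverse q)" by simp
    show "(q ^ 2 - inverse q ^ 2) / (q1 - inverse q1) = qint Node1 4"
      "qint Node1 4 + (q - inverse q) / (q1 - inverse q1) = ad_coeff"
      "ad_coeff + (inverse q - q) / (q1 - inverse q1) = qint Node1 4"
      unfolding 2 1 using q1_minus_inverse_nonzero by simp_all
  qed
  have s1: "k1 * m1 = scale (inverse q) (m1 * k1)" "m1 * F1 = scale q (F1 * m1) + scale (qint Node1 4) e0"
    using step[OF k_e(3), of 0 0 m1] e_F(4) br by (simp_all add: m1_def power2_eq_square)
  have s2: "k1 * m2 = m2 * k1" "m2 * F1 = F1 * m2 + scale ad_coeff m1"
    using step[OF s1(1), of "qint Node1 4" e0 m2] s1(2) br by (simp_all add: m2_def m1_def power2_eq_square)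
  have s3: "k1 * m3 = scale q (m3 * k1)" "m3 * F1 = scale (inverse q) (F1 * m3) + scale ad_coeff m2"
    using step[of m2 1 ad_coeff m1 m3] s2 br by (simp_all add: m3_def m2_def)
  have s4: "m4 * F1 = scale (inverse q ^ 2) (F1 * m4) + scale (qint Node1 4) m3"
    using step(2)[OF s3(1), of ad_coeff m2 m4] s3(2) br by (simp add: m4_def m3_def power2_eq_square)
  show "m1 * F1 = scale q (F1 * m1) + scale (qint Node1 4) e0"
  "m2 * F1 = F1 * m2 + scale ad_coeff m1"
  "m3 * F1 = scale (inverse q) (F1 * m3) + scale ad_coeff m2"
  "m4 * F1 = scale (inverse q ^ 2) (F1 * m4) + scale (qint Node1 4) m3"
    by fact+
qed

text \<open>
  A \<open>q\<close>-binomial expansion: the coefficients are the elementary symmetric functions of \<open>q\<^sup>-\<^sup>2, q\<^sup>-\<^sup>1, 1, q\<close>.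
\<close>

lemma m4_expand:
  "m4 = e1 ^ 4 * e0
     - scale ((1 + inverse q) * (q + inverse q)) (e1 ^ 3 * e0 * e1)
     + scale (inverse q * (q + 1 + inverse q) * (q + inverse q)) (e1 ^ 2 * e0 * e1 ^ 2)
     - scale (inverse q * (1 + inverse q) * (q + inverse q)) (e1 * e0 * e1 ^ 3)
     + scale (inverse q ^ 2) (e0 * e1 ^ 4)"
proof -
  have "(1 + inverse q) * (q + inverse q) = inverse q ^ 2 + inverse q + 1 + q"
    "inverse q * (q + 1 + inverse q) * (q + inverse q)
      = inverse q ^ 2 * inverse q + inverse q ^ 2 * 1 + inverse q ^ 2 * q + inverse q * 1 + inverse q * q + 1 * q"
    "inverse q * (1 + inverse q) * (q + inverse q)
      = inverse q ^ 2 * inverse q * 1 + inverse q ^ 2 * inverse q * q + inverse q ^ 2 * 1 * q + inverse q * 1 * q"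
    "inverse q ^ 2 = inverse q ^ 2 * inverse q * 1 * q"
    by (simp_all add: field_simps eval_nat_numeral)
  moreover have "m3 = e1 * m2 - scale 1 (m2 * e1)"
    by (simp add: m3_def)
  ultimately show ?thesis
    using iterated_commutator_4[OF m1_def m2_def _ m4_def] by metis
qed

text \<open>
  Multiplied by \<open>[4]!\<close>, which is \<open>ad_coeff * qint Node1 4\<close>, the product of the two divided powers acquires the \<open>q\<close>-binomial
  coefficient \<open>[4]! / ([r]! [4-r]!)\<close>, and \<open>m4\<close> is the \<open>q\<close>-binomial expansion with the same signs and powers of \<open>q\<^sub>1\<close>.
\<close>

lemma T1_e0_eq: "T1 e0 = scale (inverse (ad_coeff * qint Node1 4)) m4"
proof -
  (* ?A, ?B and ?A * ?D are the quantum integers [2], [3] and [4] at node 1. *)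
  let ?A = "q1 + inverse q1" and ?B = "q + 1 + inverse q" and ?D = "q + inverse q"
  have nz: "?A \<noteq> 0" "?B \<noteq> 0" "?A * ?D \<noteq> 0"
    using qint_Node1_nonzero[of 2] qint_Node1_nonzero[of 3] qint_Node1_nonzero[of 4] unfolding qint_Node1 by simp_all
  have fact: "qfact Node1 0 = 1" "qfact Node1 (Suc 0) = 1" "qfact Node1 2 = ?A" "qfact Node1 3 = ?A * ?B"
    "qfact Node1 4 = ?A * ?B * (?A * ?D)"
  proof -
    have "qfact Node1 0 = 1" "qfact Node1 (Suc n) = qfact Node1 n * qint Node1 (Suc n)" for n
      by (simp_all add: qfact_def)
    from this(1) this(2)[of 0] this(2)[of 1] this(2)[of 2] this(2)[of 3] qint_Node1
    show "qfact Node1 0 = 1" "qfact Node1 (Suc 0) = 1" "qfact Node1 2 = ?A" "qfact Node1 3 = ?A * ?B"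
      "qfact Node1 4 = ?A * ?B * (?A * ?D)"
      by (simp_all add: numeral_2_eq_2 numeral_3_eq_3 numeral_eq_Suc)
  qed
  have cp: "ad_coeff * qint Node1 4 = ?A * ?B * (?A * ?D)"
    by (simp add: ad_coeff_def qint_Node1)
  have c: "inverse q1 * inverse (?A * ?B) = inverse (?A * ?B * (?A * ?D)) * ((1 + inverse q) * ?D)"
    "inverse q1 ^ 2 * (inverse ?A * inverse ?A) = inverse (?A * ?B * (?A * ?D)) * (inverse q * ?B * ?D)"
    "inverse q1 ^ 3 * inverse (?A * ?B) = inverse (?A * ?B * (?A * ?D)) * (inverse q * (1 + inverse q) * ?D)"
    "inverse q1 ^ 4 = inverse q ^ 2"
  proof -
    have a: "1 + inverse q = inverse q1 * ?A" "inverse q1 ^ 2 = inverse q" "inverse q1 ^ 3 = inverse q * inverse q1"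
      "inverse q1 ^ 4 = inverse q ^ 2"
      by (simp_all add: q_def field_simps eval_nat_numeral)
    have gen: "z * inverse (A * B) = inverse (A * B * (A * D)) * (z * A * D)"
      "z * (inverse A * inverse A) = inverse (A * B * (A * D)) * (z * B * D)"
      if "A \<noteq> 0" "B \<noteq> 0" "D \<noteq> 0" for A B D z :: qfield
      using that by (simp_all add: field_simps)
    have nzD: "?D \<noteq> 0" using nz by simp
    show "inverse q1 * inverse (?A * ?B) = inverse (?A * ?B * (?A * ?D)) * ((1 + inverse q) * ?D)"
    "inverse q1 ^ 2 * (inverse ?A * inverse ?A) = inverse (?A * ?B * (?A * ?D)) * (inverse q * ?B * ?D)"
    "inverse q1 ^ 3 * inverse (?A * ?B) = inverse (?A * ?B * (?A * ?D)) * (inverse q * (1 + inverse q) * ?D)"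
    "inverse q1 ^ 4 = inverse q ^ 2"
      unfolding a using gen[OF nz(1,2) nzD] by (simp_all only: mult.assoc)
  qed
  have S: "(\<Sum>r\<le>4. g r) = g 0 + g 1 + g 2 + g 3 + g 4" for g :: "nat \<Rightarrow> 'a"
    by (simp add: numeral_eq_Suc)
  have D: "scale ((- 1) ^ r * inverse q1 ^ r) (divpow scale Node1 e1 (4 - r) * e0 * divpow scale Node1 e1 r)
      = scale ((- 1) ^ r * inverse q1 ^ r * (inverse (qfact Node1 (4 - r)) * inverse (qfact Node1 r)))
          (e1 ^ (4 - r) * e0 * e1 ^ r)" for r
    by (simp add: divpow_def scale_mult_left scale_mult_right)
  let ?P = "inverse (?A * ?B * (?A * ?D))"
  have C: "(- 1) ^ 0 * inverse q1 ^ 0 * (inverse (qfact Node1 (4 - 0)) * inverse (qfact Node1 0)) = ?P"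
    "(- 1) ^ 1 * inverse q1 ^ 1 * (inverse (qfact Node1 (4 - 1)) * inverse (qfact Node1 1)) = - (?P * ((1 + inverse q) * ?D))"
    "(- 1) ^ 2 * inverse q1 ^ 2 * (inverse (qfact Node1 (4 - 2)) * inverse (qfact Node1 2)) = ?P * (inverse q * ?B * ?D)"
    "(- 1) ^ 3 * inverse q1 ^ 3 * (inverse (qfact Node1 (4 - 3)) * inverse (qfact Node1 3)) = - (?P * (inverse q * (1 + inverse q) * ?D))"
    "(- 1) ^ 4 * inverse q1 ^ 4 * (inverse (qfact Node1 (4 - 4)) * inverse (qfact Node1 4)) = ?P * inverse q ^ 2"
    unfolding c[symmetric] by (simp_all add: fact del: inverse_mult_distrib)
  show ?thesis
    unfolding T1_e0 S D C m4_expand cp scale_right_distrib scale_right_diff_distrib scale_scale scale_minus_left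
    by simp
qed

lemma sigma_hom: "alg_hom scale scale \<sigma>"
  unfolding alg_hom_def \<sigma>_def
  using T_hom by (auto simp: alg_hom_def intro: Vector_Spaces.linear_compose)

lemmas sigma_simps = alg_hom_simps[OF sigma_hom]

lemma sigma_bij: "bij \<sigma>"
  unfolding \<sigma>_def using T_bij(2) T_bij(1) by (rule bij_comp)

lemma T0_m1: "T0 m1 = e1"
proof -
  have "T0 m1 = y1 * F0 - scale (inverse q ^ 2) (F0 * y1)"
    by (simp add: m1_def T_simps y1_def F0_def)
  then show ?thesis using y1_F0 by simp
qed

lemma T0_m2: "T0 m2 = psi1"
  by (simp add: m2_def T_simps T0_m1 psi1_def y1_def)

text \<open>
  \<open>T1\<close> turns a \<open>q\<close>-commutator with \<open>e1\<close> into one with \<open>F1\<close>, so starting from \<open>T1 e0\<close>, a multiple of \<open>m4\<close>, it runs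
  down the string.
\<close>

lemma T1_y1: "T1 y1 = scale (inverse ad_coeff) m3"
proof -
  have "T1 y1 = scale (inverse (ad_coeff * qint Node1 4)) (m4 * F1 - scale (inverse q ^ 2) (F1 * m4))"
    by (simp add: y1_eq T_simps T1_e0_eq F1_def[symmetric] scale_mult_left scale_mult_right
       scale_right_diff_distrib mult_ac)
  then show ?thesis using chain(4) ad_coeff_nonzero qint_Node1_nonzero[of 4] by simp
qed

lemma T1_psi1: "T1 psi1 = m2"
proof -
  have "T1 psi1 = scale (inverse ad_coeff) (m3 * F1 - scale (inverse q) (F1 * m3))"
    by (simp add: psi1_def T_simps T1_y1 F1_def[symmetric] scale_mult_left scale_mult_right
       scale_right_diff_distrib mult_ac)
  then show ?thesis using chain(3) ad_coeff_nonzero by simp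
qed

text \<open>
  Both \<open>T1\<close>, going down the string, and the inverse of \<open>T0\<close>, going up from \<open>m1\<close>, carry \<open>psi1\<close> to the middle term \<open>m2\<close>.
\<close>

lemma sigma_psi1: "\<sigma> psi1 = psi1"
  by (simp add: \<sigma>_def T1_psi1 T0_m2)

lemma sigma_ad_e1: "\<sigma> (psi1 * e1 - e1 * psi1) = scale ad_coeff e1"
proof -
  have "T1 (psi1 * e1 - e1 * psi1) = scale ad_coeff m1"
    by (simp add: T_simps T1_psi1 F1_def[symmetric] chain(2))
  then show ?thesis by (simp add: \<sigma>_def T_simps T0_m1)
qed

lemma ad_y1: "y1 * psi1 - psi1 * y1 = scale ad_coeff (\<sigma> y1)"
proof -
  have "y1 * psi1 - psi1 * y1 = T0 m3"
    by (simp add: m3_def T_simps T0_m2 y1_def)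
  then show ?thesis
    using ad_coeff_nonzero by (simp add: \<sigma>_def T1_y1 T_simps)
qed

text \<open>
  The two quadratic elements are images under \<open>T0\<close> of \<open>q\<close>-commutators along the string: one step down from \<open>m1\<close> to \<open>e0\<close>,
  and one step up from \<open>m3\<close> to \<open>m4\<close>, which is a multiple of \<open>T1 e0\<close>.
\<close>

lemma quad_e1: "e1 * \<sigma> e1 - scale q (\<sigma> e1 * e1) = scale (qint Node1 4) F0"
proof -
  have "e1 * \<sigma> e1 - scale q (\<sigma> e1 * e1) = T0 (m1 * F1 - scale q (F1 * m1))"
    by (simp add: \<sigma>_def T_simps T0_m1 F1_def)
  then show ?thesis by (simp add: chain(1) T_simps F0_def)
qed

lemma quad_y1: "y1 * \<sigma> y1 - scale q (\<sigma> y1 * y1) = scale (qint Node1 4) (\<sigma> e0)"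
proof -
  have "y1 * \<sigma> y1 - scale q (\<sigma> y1 * y1) = scale (inverse ad_coeff) (T0 m4)"
    by (simp add: m4_def \<sigma>_def T_simps T1_y1 y1_def[symmetric] scale_mult_left scale_mult_right scale_right_diff_distrib mult_ac)
  then show ?thesis using ad_coeff_nonzero qint_Node1_nonzero[of 4] by (simp add: \<sigma>_def T1_e0_eq T_simps)
qed

lemma ad_F0: "psi1 * F0 - F0 * psi1 = scale (q ^ 2 - inverse q) (e1 * e1)"
proof -
  have y: "y1 * (F0 * z) = scale (inverse q ^ 2) (F0 * (y1 * z)) + e1 * z"
    and e: "e1 * (F0 * z) = scale (q ^ 2) (F0 * (e1 * z))" for z
    using arg_cong[OF y1_F0, of "\<lambda>t. t * z"] arg_cong[OF e_F(3), of "\<lambda>t. t * z"]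
    by (simp_all add: algebra_simps scale_mult_left)
  show ?thesis
    by (simp add: psi1_def algebra_simps scale_mult_left scale_mult_right y e y1_F0 e_F(3) power2_eq_square)
qed

text \<open>
  The Serre relation, with \<open>e0 * e1 * e0\<close> split according to \<open>q\<^sup>2 + q\<^sup>-\<^sup>2\<close>.
\<close>

lemma y1_e0: "y1 * e0 = scale (inverse q ^ 2) (e0 * y1)"
proof -
  have "scale (inverse q ^ 2) (e0 * e0 * e1 + e1 * e0 * e0) = scale (inverse q ^ 2 * (q ^ 2 + inverse q ^ 2)) (e0 * e1 * e0)"
    by (simp add: serre_0)
  then have "scale (inverse q ^ 2) (e0 * e0 * e1) + scale (inverse q ^ 2) (e1 * e0 * e0)
     = e0 * e1 * e0 + scale (inverse q ^ 2 * inverse q ^ 2) (e0 * e1 * e0)"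
    by (simp add: ring_distribs scale_left_distrib scale_right_distrib power_inverse)
  then show ?thesis
    by (simp add: y1_eq algebra_simps scale_mult_left scale_mult_right)
qed

lemma ad_e0: "e0 * psi1 - psi1 * e0 = scale (q ^ 2 - inverse q) (y1 * y1)"
proof -
  have y: "y1 * (e0 * z) = scale (inverse q ^ 2) (e0 * (y1 * z))" for z
    using arg_cong[OF y1_e0, of "\<lambda>t. t * z"]
    by (simp add: scale_mult_left mult.assoc)
  have e1_e0: "e1 * e0 = scale (q ^ 2) (e0 * e1 - y1)"
    by (simp add: y1_eq power_inverse)
  have e: "e1 * (e0 * z) = scale (q ^ 2) (e0 * (e1 * z) - y1 * z)" for z
    using arg_cong[OF e1_e0, of "\<lambda>t. t * z"] by (simp add: scale_mult_left algebra_simps)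
  show ?thesis
    by (simp add: psi1_def algebra_simps scale_mult_left scale_mult_right y e y1_e0 e1_e0 power2_eq_square)
qed

text \<open>
  The relations of low degree, established at one index above, spread to all indices under \<open>\<sigma>\<close>.
\<close>

theorem imaginary_root_vectors_commute:
  assumes E: "\<And>n. E n = (inv \<sigma> ^^ n) e1"
    and psi_0: "\<psi> 0 = scale (inverse (q1 - inverse q1)) 1"
    and psi_Suc: "\<And>n. \<psi> (Suc n) = y1 * E n - scale (inverse q) (E n * y1)"
  shows "\<psi> k * \<psi> l = \<psi> l * \<psi> k"
proof -
  obtain x where x: "x 0 = e1" "\<And>r. \<sigma> (x r) = x (r - 1)" "\<And>n. x (int n) = (inv \<sigma> ^^ n) e1"
    using bij_orbit[OF sigma_bij] by metis
  obtain y' :: "int \<Rightarrow> 'a" where y': "y' 0 = y1" "\<And>r. \<sigma> (y' r) = y' (r - 1)"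
    using bij_orbit[OF sigma_bij] by metis
  define y where "y t = y' (1 - t)" for t
  have y: "y 1 = y1" "\<sigma> (y t) = y (t + 1)" for t
    using y'(1) y'(2)[of "1 - t"] by (simp_all add: y_def algebra_simps)
  have y_minus: "\<sigma> (y (a - r)) = y (a - (r - 1))" for a r
    using y(2)[of "a - r"] by (simp add: algebra_simps)
  have y_minus': "\<sigma> (y (- r)) = y (- (r - 1))" for r
    using y_minus[of 0 r] by simp
  note shift = shift_eq[OF bij_is_inj[OF sigma_bij]]
  have psi_Suc_0: "\<psi> (Suc 0) = psi1"
    by (simp add: psi_Suc E psi1_def)
  have y0: "\<sigma> (y 0) = y1" using y(2)[of 0] y(1) by simp
  have ad_x: "psi1 * x r - x r * psi1 = scale ad_coeff (x (r + 1))" for r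
  proof (rule shift[where A = "\<lambda>r. psi1 * x r - x r * psi1" and B = "\<lambda>r. scale ad_coeff (x (r + 1))" and k = 0])
    have "\<sigma> (psi1 * x 0 - x 0 * psi1) = \<sigma> (scale ad_coeff (x 1))"
      using sigma_ad_e1 x(2)[of 1] by (simp add: x(1) sigma_simps)
    then show "psi1 * x 0 - x 0 * psi1 = scale ad_coeff (x (0 + 1))"
      using bij_is_inj[OF sigma_bij] by (simp add: inj_eq)
  qed (simp_all add: sigma_simps sigma_psi1 x(2))
  have ad_y: "y r * psi1 - psi1 * y r = scale ad_coeff (y (r + 1))" for r
  proof -
    have "y (- r) * psi1 - psi1 * y (- r) = scale ad_coeff (y (1 - r))" for r
    proof (rule shift[where A = "\<lambda>r. y (- r) * psi1 - psi1 * y (- r)" and B = "\<lambda>r. scale ad_coeff (y (1 - r))" and k = "-1"])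
      show "y (- (- 1)) * psi1 - psi1 * y (- (- 1)) = scale ad_coeff (y (1 - (- 1)))"
        using ad_y1 y(1) y(2)[of 1] by simp
    qed (simp_all add: sigma_simps sigma_psi1 y_minus y_minus')
    from this[of "- r"] show ?thesis by (simp add: add.commute)
  qed
  have F0_e1: "scale (qint Node1 4) (psi1 * F0 - F0 * psi1) = scale quad_coeff (e1 * e1)"
    by (simp add: ad_F0 quad_coeff_def)
  have zx: "R.quad x (- 1) = scale (qint Node1 4) F0"
    using quad_e1 x(1) x(2)[of 0] by (simp add: R.quad_def)
  have zy: "L.quad y 0 = scale (qint Node1 4) e0"
  proof -
    have "\<sigma> (L.quad y 0) = \<sigma> (scale (qint Node1 4) e0)"
      using quad_y1 y(1) y(2)[of 1] y0 by (simp add: L.quad_def sigma_simps)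
    then show ?thesis
      using bij_is_inj[OF sigma_bij] by (simp add: inj_eq)
  qed
  have quad_x_shift: "\<sigma> (R.quad x r) = R.quad x (r - 1)" for r
    by (simp add: R.quad_def sigma_simps x(2))
  have quad_y_shift: "\<sigma> (L.quad y (- r)) = L.quad y (- (r - 1))" for r
    using y_minus[of 1 r] by (simp add: L.quad_def sigma_simps y_minus' algebra_simps)
  have "loop_currents scale x y \<psi>"
  proof unfold_locales
    show "\<psi> 0 = scale (inverse (q1 - inverse q1)) 1" by (rule psi_0)
    show "\<psi> (Suc n) = R.bracket x y (int n) 1" for n
      by (simp add: R.bracket_def psi_Suc x(3) E y(1))
    show "R.bracket x y r (1 - r) = \<psi> (Suc 0)" for r
    proof (rule shift[where A = "\<lambda>r. R.bracket x y r (1 - r)" and B = "\<lambda>r. \<psi> (Suc 0)" and k = 0])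
      show "R.bracket x y 0 (1 - 0) = \<psi> (Suc 0)"
        by (simp add: R.bracket_def psi_Suc_0 psi1_def x(1) y(1))
    qed (simp_all add: psi_Suc_0 sigma_psi1 R.bracket_def sigma_simps x(2) y_minus)
    show "R.comm (\<psi> (Suc 0)) (x r) = scale ad_coeff (x (r + 1))" for r
      by (simp add: R.comm_def psi_Suc_0 ad_x)
    show "L.comm (\<psi> (Suc 0)) (y r) = scale ad_coeff (y (r + 1))" for r
      by (simp add: L.comm_def psi_Suc_0 ad_y)
    show "R.comm (\<psi> (Suc 0)) (R.quad x r) = scale quad_coeff (x (r + 1) * x (r + 1))" for r
    proof (rule shift[where A = "\<lambda>r. R.comm (\<psi> (Suc 0)) (R.quad x r)" and B = "\<lambda>r. scale quad_coeff (x (r + 1) * x (r + 1))" and k = "-1"])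
      show "R.comm (\<psi> (Suc 0)) (R.quad x (- 1)) = scale quad_coeff (x (- 1 + 1) * x (- 1 + 1))"
        using F0_e1 by (simp add: R.comm_def psi_Suc_0 zx x(1) scale_mult_left scale_mult_right scale_right_diff_distrib)
    qed (simp_all add: R.comm_def psi_Suc_0 sigma_simps sigma_psi1 quad_x_shift x(2))
    show "L.comm (\<psi> (Suc 0)) (L.quad y r) = scale quad_coeff (y (r + 1) * y (r + 1))" for r
    proof -
      have "L.comm (\<psi> (Suc 0)) (L.quad y (- r)) = scale quad_coeff (y (1 - r) * y (1 - r))" for r
      proof (rule shift[where A = "\<lambda>r. L.comm (\<psi> (Suc 0)) (L.quad y (- r))" and B = "\<lambda>r. scale quad_coeff (y (1 - r) * y (1 - r))" and k = 0])
        have "scale (qint Node1 4) (e0 * psi1 - psi1 * e0) = scale quad_coeff (y1 * y1)"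
          by (simp add: ad_e0 quad_coeff_def)
        then show "L.comm (\<psi> (Suc 0)) (L.quad y (- 0)) = scale quad_coeff (y (1 - 0) * y (1 - 0))"
          by (simp add: L.comm_def psi_Suc_0 zy y(1) scale_mult_left scale_mult_right scale_right_diff_distrib)
      qed (simp_all add: L.comm_def psi_Suc_0 sigma_simps sigma_psi1 quad_y_shift y_minus)
      from this[of "- r"] show ?thesis by (simp add: add.commute)
    qed
    show "y (- r) * R.quad x r - scale (inverse q ^ 2) (R.quad x r * y (- r)) = scale (qint Node1 4) (x (r + 1))" for r
    proof (rule shift[where A = "\<lambda>r. y (- r) * R.quad x r - scale (inverse q ^ 2) (R.quad x r * y (- r))"
          and B = "\<lambda>r. scale (qint Node1 4) (x (r + 1))" and k = "-1"])
      have "scale (qint Node1 4) (y1 * F0 - scale (inverse q ^ 2) (F0 * y1)) = scale (qint Node1 4) e1"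
        by (simp add: y1_F0)
      then show "y (- (- 1)) * R.quad x (- 1) - scale (inverse q ^ 2) (R.quad x (- 1) * y (- (- 1))) = scale (qint Node1 4) (x (- 1 + 1))"
        by (simp add: zx x(1) y(1) scale_mult_left scale_mult_right scale_right_diff_distrib mult.commute)
    qed (simp_all add: sigma_simps quad_x_shift x(2) y_minus')
    show "L.quad y r * x (- r) - scale (inverse q ^ 2) (x (- r) * L.quad y r) = scale (qint Node1 4) (y (r + 1))" for r
    proof -
      have "L.quad y (- r) * x r - scale (inverse q ^ 2) (x r * L.quad y (- r)) = scale (qint Node1 4) (y (1 - r))" for r
      proof (rule shift[where A = "\<lambda>r. L.quad y (- r) * x r - scale (inverse q ^ 2) (x r * L.quad y (- r))"
          and B = "\<lambda>r. scale (qint Node1 4) (y (1 - r))" and k = 0])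
        have "scale (qint Node1 4) (e0 * e1 - scale (inverse q ^ 2) (e1 * e0)) = scale (qint Node1 4) y1"
          by (simp add: y1_eq)
        then show "L.quad y (- 0) * x 0 - scale (inverse q ^ 2) (x 0 * L.quad y (- 0)) = scale (qint Node1 4) (y (1 - 0))"
          by (simp add: zy x(1) y(1) scale_mult_left scale_mult_right scale_right_diff_distrib mult.commute)
      qed (simp_all add: sigma_simps quad_y_shift x(2) y_minus)
      from this[of "- r"] show ?thesis by (simp add: add.commute)
    qed
  qed
  then show ?thesis by (rule loop_currents.psi_commute)
qed

end

section \<open>The algebra given by generators and relations\<close>

text \<open>
  A homomorphism from the free algebra carries relators to relators, since each is an expression in the generators.
\<close>

lemma relator_zero:
  assumes G: "is_quantum_algebra sY pairing \<alpha> h s G" and "r \<in> relators sY pairing \<alpha> h s G"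
  shows "r = 0"
proof -
  from G obtain \<Phi> where hom: "alg_hom free_scale s \<Phi>" and gen: "\<And>g. \<Phi> (free_gen g) = G g"
    and ker: "{x. \<Phi> x = 0} = two_sided_ideal (relators sY pairing \<alpha> h free_scale free_gen)"
    by (auto simp: is_quantum_algebra_def)
  note hs = alg_hom_simps[OF hom]
  have pow: "\<Phi> (z ^ n) = \<Phi> z ^ n" for z n
    by (induction n) (simp_all add: hs)
  have sum: "\<Phi> (sum g A) = (\<Sum>a\<in>A. \<Phi> (g a))" for g and A :: "nat set"
    by (induction A rule: infinite_finite_induct) (simp_all add: hs)
  have div: "\<Phi> (divpow free_scale i z n) = divpow s i (\<Phi> z) n" for i z n
    by (simp add: divpow_def hs pow)
  have serre: "\<Phi> (serre free_scale i j z w) = serre s i j (\<Phi> z) (\<Phi> w)" for i j z w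
    by (simp add: serre_def Let_def sum hs div pow)
  have "relators sY pairing \<alpha> h s G \<subseteq> \<Phi> ` relators sY pairing \<alpha> h free_scale free_gen"
    unfolding relators_def Let_def gen[symmetric] serre[symmetric] hs[symmetric]
    by (intro Un_least) blast+
  with assms(2) obtain r' where "r = \<Phi> r'" "r' \<in> relators sY pairing \<alpha> h free_scale free_gen"
    by blast
  then show "r = 0"
    using ker by (blast intro: two_sided_ideal.gen)
qed

theorem proposition3p29:
  fixes sX :: "int \<Rightarrow> 'x::ab_group_add \<Rightarrow> 'x"
    and sY :: "int \<Rightarrow> 'y::ab_group_add \<Rightarrow> 'y"
    and pairing :: "'y \<Rightarrow> 'x \<Rightarrow> int"
    and \<alpha> :: "node \<Rightarrow> 'x"
    and h :: "node \<Rightarrow> 'y"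
    and s :: "qfield \<Rightarrow> 'u::ring_1 \<Rightarrow> 'u"
    and G :: "'y gen \<Rightarrow> 'u"
    and T :: "node \<Rightarrow> 'u \<Rightarrow> 'u"
    and k l :: nat
  assumes "root_datum_A22 sX sY pairing \<alpha> h"
    and "is_quantum_algebra sY pairing \<alpha> h s G"
    and "\<And>i. is_braid_automorphism sY pairing \<alpha> h s G i (T i)"
  shows "psi s G T k * psi s G T l - psi s G T l * psi s G T k = 0"
proof -
  interpret root_datum_A22 sX sY pairing \<alpha> h by fact
  interpret q_algebra s using assms(2) by (simp add: is_quantum_algebra_def)
  let ?e = "\<lambda>i. G (Egen i)" and ?f = "\<lambda>i. G (Fgen i)" and ?Q = "\<lambda>y. G (Qgen y)"
  let ?k = "kexp sY h"
  have rel: "?Q 0 - 1 = 0" "?Q y * ?Q y' - ?Q (y + y') = 0"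
    "?Q y * ?e i * ?Q (- y) - s (q1 powi pairing y (\<alpha> i)) (?e i) = 0"
    "(?e i * ?f i - ?f i * ?e i)
       - s (inverse (qnode i - inverse (qnode i))) (?Q (?k i) - ?Q (- ?k i)) = 0"
    "i \<noteq> j \<Longrightarrow> ?e i * ?f j - ?f j * ?e i = 0"
    "i \<noteq> j \<Longrightarrow> serre s i j (?e i) (?e j) = 0" for y y' i j
    by (rule relator_zero[OF assms(2)], unfold relators_def Let_def, blast)+
  have Q: "?Q 0 = 1" "?Q y * ?Q y' = ?Q (y + y')" for y y'
    using rel(1,2) by simp_all
  have Q_e: "?Q y * ?e i = s (q1 powi pairing y (\<alpha> i)) (?e i * ?Q y)" for y i
  proof -
    have "?Q y * ?e i * ?Q (- y) = s (q1 powi pairing y (\<alpha> i)) (?e i)"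
      using rel(3) by simp
    from arg_cong[OF this, of "\<lambda>t. t * ?Q y"] show ?thesis
      by (simp add: mult.assoc Q scale_mult_left)
  qed
  have e_f: "?e i * ?f i - ?f i * ?e i = s (inverse (qnode i - inverse (qnode i))) (?Q (?k i) - ?Q (- ?k i))" for i
    using rel(4) by simp
  have e_f': "?e i * ?f j = ?f j * ?e i" if "i \<noteq> j" for i j
    using rel(5)[OF that] by simp
  have serre: "serre s Node0 Node1 (?e Node0) (?e Node1) = 0"
    by (rule rel(6)) simp
  have pairing_scale: "pairing (sY c y) x = c * pairing y x" for c y x
  proof -
    have "additive (\<lambda>y. pairing y x)"
      using perfect_right by (auto simp: bij_betw_def)
    then interpret additive "\<lambda>y. pairing y x" .
    show ?thesis
    proof (induction c rule: int_induct[where k = 0])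
      case base
      show ?case by (simp add: zero)
    next
      case (step1 i)
      then show ?case by (simp add: Y.scale_left_distrib add algebra_simps)
    next
      case (step2 i)
      then show ?case by (simp add: Y.scale_left_diff_distrib diff algebra_simps)
    qed
  qed
  have braid: "alg_hom s s (T i)" "bij (T i)" "T i (?e i) = - (?f i * ?Q (?k i))" for i
    using assms(3)[of i] by (simp_all add: is_braid_automorphism_def Let_def)
  have T_e: "T i (?e j) = (\<Sum>r = 0..nat (- cartan i j). s ((- 1) ^ r * inverse (qnode i) ^ r)
       (divpow s i (?e i) (nat (- cartan i j) - r) * ?e j * divpow s i (?e i) r))" if "j \<noteq> i" for i j
    using assms(3)[of i] that by (simp add: is_braid_automorphism_def Let_def)
  have qfact0: "qfact Node0 0 = 1" "qfact Node0 (Suc 0) = 1" "qfact Node0 2 = q ^ 2 + inverse q ^ 2"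
    using qint_Node0 by (simp_all add: qfact_def numeral_2_eq_2)
  interpret B: braided s "?e Node0" "?e Node1" "?f Node0" "?f Node1" "?Q (?k Node0)" "?Q (?k Node1)"
    "?Q (- ?k Node0)" "?Q (- ?k Node1)" "T Node0" "T Node1"
  proof
    show "?Q (- ?k Node0) * ?Q (?k Node0) = 1" "?Q (- ?k Node1) * ?Q (?k Node1) = 1"
      by (simp_all only: Q add.left_inverse)
    show "?Q (?k Node0) * ?e Node0 = s (q ^ 4) (?e Node0 * ?Q (?k Node0))"
      "?Q (?k Node0) * ?e Node1 = s (inverse q ^ 2) (?e Node1 * ?Q (?k Node0))"
      "?Q (?k Node1) * ?e Node0 = s (inverse q ^ 2) (?e Node0 * ?Q (?k Node1))"
      "?Q (?k Node1) * ?e Node1 = s q (?e Node1 * ?Q (?k Node1))"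
      by (simp_all add: Q_e pairing_scale pairing_cartan power_int_def q_def power_mult[symmetric] power_inverse)
    show "?e Node0 * ?f Node0 = ?f Node0 * ?e Node0
        + s (inverse (q ^ 2 - inverse q ^ 2)) (?Q (?k Node0) - ?Q (- ?k Node0))"
      using e_f[of Node0] by (simp add: diff_eq_eq add.commute power_inverse)
    show "?e Node1 * ?f Node1 = ?f Node1 * ?e Node1
        + s (inverse (q1 - inverse q1)) (?Q (?k Node1) - ?Q (- ?k Node1))"
      using e_f[of Node1] by (simp add: diff_eq_eq add.commute)
    show "?e Node0 * ?f Node1 = ?f Node1 * ?e Node0" "?e Node1 * ?f Node0 = ?f Node0 * ?e Node1"
      by (simp_all add: e_f')
    show "?e Node0 * ?e Node0 * ?e Node1 + ?e Node1 * ?e Node0 * ?e Node0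
        = s (q ^ 2 + inverse q ^ 2) (?e Node0 * ?e Node1 * ?e Node0)"
    proof -
      let ?b = "q ^ 2 + inverse q ^ 2"
      have "(\<Sum>k = 0..2. g k) = g 0 + g 1 + g 2" for g :: "nat \<Rightarrow> 'u"
        by (simp add: numeral_2_eq_2)
      then have "s (inverse ?b) (?e Node1 * (?e Node0 * ?e Node0)) - ?e Node0 * (?e Node1 * ?e Node0)
          + s (inverse ?b) (?e Node0 * (?e Node0 * ?e Node1)) = 0"
        using serre
        by (simp add: serre_def divpow_def qfact0 scale_mult_left scale_mult_right power2_eq_square mult.assoc)
      from arg_cong[OF this, of "s ?b"] show ?thesis
        using qint_Node0(3)
        by (simp add: scale_right_distrib scale_right_diff_distrib mult.assoc add_diff_eq add.commute)
    qed
    show "alg_hom s s (T Node0)" "alg_hom s s (T Node1)" "bij (T Node0)" "bij (T Node1)"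
      "T Node0 (?e Node0) = - (?f Node0 * ?Q (?k Node0))"
      "T Node1 (?e Node1) = - (?f Node1 * ?Q (?k Node1))"
      by (rule braid)+
    show "T Node0 (?e Node1) = ?e Node0 * ?e Node1 - s (inverse q ^ 2) (?e Node1 * ?e Node0)"
      by (simp add: T_e divpow_def qfact0 power_inverse)
    show "T Node1 (?e Node0) = (\<Sum>r\<le>4. s ((- 1) ^ r * inverse q1 ^ r)
        (divpow s Node1 (?e Node1) (4 - r) * ?e Node0 * divpow s Node1 (?e Node1) r))"
      by (simp add: T_e atLeast0AtMost)
  qed
  have "psi s G T k * psi s G T l = psi s G T l * psi s G T k"
  proof (rule B.imaginary_root_vectors_commute)
    show "E_plus G T n = (inv B.\<sigma> ^^ n) (?e Node1)" for n
      using braid(2) by (simp add: E_plus_def B.\<sigma>_def o_inv_distrib)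
  qed (simp_all add: E_plus_def E_minus_def B.y1_def)
  then show ?thesis by simp
qed

end
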